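(* For $\epsilon>0$ set $d=\epsilon^{-1/4}$. Then for all sufficiently small $\epsilon$ the following holds. Let $\mathcal{A}$ be a TDS learning algorithm for $\frac13$-balanced intersections of $2$ general halfspaces over $\mathbb{R}^d$ w.r.t. $\mathcal{N}_d$, with accuracy parameter $\epsilon$ and success probability at least $0.95$. Suppose $\mathcal{A}$ obtains at most $d^{\frac{\log 1/\epsilon}{\log\log 1/\epsilon}}$ samples from the training distribution and accesses the test distribution via $2^{d^{o(1)}}$ SQ queries of tolerance $\phi>0$ (the queries may depend on the training samples). Then $\phi\le d^{-\Omega(\frac{\log 1/\epsilon}{\log\log 1/\epsilon})}$.
   Context: $\mathcal{N}_d$ is the standard Gaussian on $\mathbb{R}^d$. An intersection of 2 general halfspaces is $\mathbf{x}\mapsto 2(\mathbb{1}\{\mathbf{w}^1\cdot\mathbf{x}+\tau^1\ge0\}\wedge\mathbb{1}\{\mathbf{w}^2\cdot\mathbf{x}+\tau^2\ge0\})-1$. A function $f$ is $\eta$-balanced if $\Pr_{\mathbf{x}\sim\mathcal{N}_d}[f(\mathbf{x})=1]\in[\eta,1-\eta]$. SQ access with tolerance $\phi$ to $\mathcal{D}$: queries $q:\mathbb{R}^d\to[-1,1]$ answered by $v$ with $|v-\mathbb{E}_{\mathcal{D}}[q]|\le\phi$. TDS learning algorithm (accuracy $\epsilon$, success probability $1-\delta$): given labeled examples $(\mathbf{x},c^*(\mathbf{x}))$, $\mathbf{x}\sim\mathcal{N}_d$ i.i.d., $c^*$ in the class, and access to an arbitrary test distribution $\mathcal{D}'$,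 it rejects or accepts and outputs $h$; with probability $\ge1-\delta$, acceptance implies $\Pr_{\mathcal{D}'}[c^*\ne h]\le\epsilon$, and if $\mathcal{D}'=\mathcal{N}_d$ it accepts with probability $\ge1-\delta$. *)

theory Defs
  imports "HOL-Probability.Probability"
begin

text \<open>
  The dimension \<open>d\<close> varies inside the theorem, so it cannot be a type: a point of Euclidean
  \<open>d\<close>-space is a function in the extensional product \<open>{..<d} \<rightarrow>\<^sub>E UNIV\<close>.
\<close>

type_synonym point = "nat \<Rightarrow> real"

abbreviation borel_space :: "nat \<Rightarrow> point measure" where
  "borel_space d \<equiv> PiM {..<d} (\<lambda>_. borel)"

definition std_gaussian :: "nat \<Rightarrow> point measure" where
  "std_gaussian d = PiM {..<d} (\<lambda>_. density lborel (\<lambda>t. ennreal (std_normal_density t)))"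

definition dot :: "nat \<Rightarrow> point \<Rightarrow> point \<Rightarrow> real" where
  "dot d w x = (\<Sum>i<d. w i * x i)"

definition intersection_of_2_halfspaces ::
    "nat \<Rightarrow> point \<Rightarrow> real \<Rightarrow> point \<Rightarrow> real \<Rightarrow> point \<Rightarrow> real" where
  "intersection_of_2_halfspaces d w1 \<tau>1 w2 \<tau>2 x =
     2 * of_bool (dot d w1 x + \<tau>1 \<ge> 0 \<and> dot d w2 x + \<tau>2 \<ge> 0) - 1"

definition balanced :: "nat \<Rightarrow> real \<Rightarrow> (point \<Rightarrow> real) \<Rightarrow> bool" where
  "balanced d \<eta> f \<longleftrightarrow>
     measure (std_gaussian d) {x \<in> space (std_gaussian d). f x = 1} \<in> {\<eta>..1 - \<eta>}"

definition balanced_intersections :: "nat \<Rightarrow> real \<Rightarrow> (point \<Rightarrow> real) set" where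
  "balanced_intersections d \<eta> =
     {f. (\<exists>w1 \<tau>1 w2 \<tau>2. f = intersection_of_2_halfspaces d w1 \<tau>1 w2 \<tau>2) \<and> balanced d \<eta> f}"

text \<open>
  Queries are extensional, so that a query is determined by its values on the space itself.
\<close>

definition sq_queries :: "nat \<Rightarrow> (point \<Rightarrow> real) set" where
  "sq_queries d = borel_measurable (borel_space d) \<inter> (space (borel_space d) \<rightarrow>\<^sub>E {-1..1})"

definition hypotheses :: "nat \<Rightarrow> (point \<Rightarrow> real) set" where
  "hypotheses d = borel_measurable (borel_space d) \<inter> (space (borel_space d) \<rightarrow> {-1, 1})"

text \<open>
  An oracle fixes one admissible answer for each query. Learners below must succeed against every
  such oracle, that is, for every admissible choice of the answers.
\<close>

definition sq_oracle :: "nat \<Rightarrow> real \<Rightarrow> point measure \<Rightarrow> ((point \<Rightarrow> real) \<Rightarrow> real) \<Rightarrow> bool" where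
  "sq_oracle d \<phi> D orc \<longleftrightarrow> (\<forall>q \<in> sq_queries d. \<bar>orc q - (\<integral>x. q x \<partial>D)\<bar> \<le> \<phi>)"

text \<open>
  The interaction of an algorithm with the test distribution, once its training sample and its
  internal randomness are fixed: each query may depend on the answers to the earlier ones. No
  computational restriction is imposed.
\<close>

datatype sq_algorithm =
    Reject
  | Accept "point \<Rightarrow> real"
  | Query "point \<Rightarrow> real" "real \<Rightarrow> sq_algorithm"

inductive at_most_queries :: "nat \<Rightarrow> nat \<Rightarrow> sq_algorithm \<Rightarrow> bool" for d where
  "at_most_queries d n Reject"
| "h \<in> hypotheses d \<Longrightarrow> at_most_queries d n (Accept h)"
| "q \<in> sq_queries d \<Longrightarrow> (\<And>v. at_most_queries d n (k v)) \<Longrightarrow> at_most_queries d (Suc n) (Query q k)"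

text \<open>The result is \<open>None\<close> for rejection and \<open>Some h\<close> for acceptance with hypothesis \<open>h\<close>.\<close>

primrec run :: "((point \<Rightarrow> real) \<Rightarrow> real) \<Rightarrow> sq_algorithm \<Rightarrow> (point \<Rightarrow> real) option" where
  "run orc Reject = None"
| "run orc (Accept h) = Some h"
| "run orc (Query q k) = run orc (k (orc q))"

text \<open>
  For a measurable event this says that its probability is at least \<open>p\<close>. In general it bounds the
  inner probability, so that algorithms and oracles need not be measurable.
\<close>

definition with_prob_at_least :: "'a measure \<Rightarrow> real \<Rightarrow> ('a \<Rightarrow> bool) \<Rightarrow> bool" where
  "with_prob_at_least M p P \<longleftrightarrow> (\<exists>E \<in> sets M. measure M E \<ge> p \<and> (\<forall>\<omega>\<in>E. P \<omega>))"

definition labeled_sample ::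
    "nat \<Rightarrow> (point \<Rightarrow> real) \<Rightarrow> (nat \<Rightarrow> point) \<Rightarrow> (point \<times> real) list" where
  "labeled_sample m f X = map (\<lambda>i. (X i, f (X i))) [0..<m]"

text \<open>
  \<open>A\<close> is a TDS learner for the class \<open>C\<close> with respect to the standard Gaussian, with accuracy
  \<open>\<epsilon>\<close> and success probability at least \<open>p\<close>. It draws \<open>m\<close> labeled training examples and a seed from
  \<open>R\<close>, then makes at most \<open>n\<close> statistical queries of tolerance \<open>\<phi>\<close> to the test distribution \<open>D'\<close>.
  The seed space is an arbitrary probability space on the reals; this includes the uniform
  distribution on the unit interval, hence any sequence of coin tosses.
\<close>

definition sq_tds_learner ::
    "nat \<Rightarrow> (point \<Rightarrow> real) set \<Rightarrow> real \<Rightarrow> real \<Rightarrow> nat \<Rightarrow> nat \<Rightarrow> real \<Rightarrow> real measure \<Rightarrow>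
     ((point \<times> real) list \<Rightarrow> real \<Rightarrow> sq_algorithm) \<Rightarrow> bool" where
  "sq_tds_learner d C \<epsilon> p m n \<phi> R A \<longleftrightarrow>
     prob_space R \<and>
     (\<forall>s r. at_most_queries d n (A s r)) \<and>
     (\<forall>f\<in>C. \<forall>D' orc. prob_space D' \<longrightarrow> sets D' = sets (borel_space d) \<longrightarrow> sq_oracle d \<phi> D' orc \<longrightarrow>
        (let \<Omega> = PiM {..<m} (\<lambda>_. std_gaussian d) \<Otimes>\<^sub>M R;
             outcome = (\<lambda>(X, r). run orc (A (labeled_sample m f X) r))
         in with_prob_at_least \<Omega> p
              (\<lambda>\<omega>. \<forall>h. outcome \<omega> = Some h \<longrightarrow> measure D' {x \<in> space D'. f x \<noteq> h x} \<le> \<epsilon>) \<and>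
            (D' = std_gaussian d \<longrightarrow> with_prob_at_least \<Omega> p (\<lambda>\<omega>. outcome \<omega> \<noteq> None))))"

end

(*
  Idea. Fix the halfspace f0 = {x_0 >= 0} and cut off a half-line far out in a hidden direction v:
  f_v = {x_0 >= 0, v.x <= T}. With T^2 a large multiple of L^2 / ln L, where L = ln (1 / eps), no
  training example separates f0 from f_v. The test distribution

    D_v = N(0,I) + beta * (N(Theta v, I) - sum_k w_k N(theta_k v, I)),   beta = 20 eps, Theta = T + 2,

  uses Lagrange weights w_k at nodes theta_k in [0,1], so that D_v and N(0,I) have the same moments
  up to degree t ~ L / ln L in direction v; for these t the weights stay below eps^(-1/4) and D_v is
  nonnegative. It gives mass more than 2 eps to {f0 <> f_v}. Because
  E[exp(a u.x - a^2/2) exp(b v.x - b^2/2)] = exp(a b u.v) for unit vectors u and v, the correlation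
  of D_u and D_v is of order (Theta^2 u.v)^(t+1). Over the directions with entries +-1/sqrt(d-1),
  all but an exponentially small fraction of the pairs are nearly orthogonal, so each query
  distinguishes D_v from N(0,I) for very few v only.
  If no query does, the learner accepts as it does for N(0,I), and its hypothesis would be eps-close
  to both f0 and f_v under D_v.
*)
theory Submission
  imports Defs "HOL-Computational_Algebra.Polynomial" "HOL-Real_Asymp.Real_Asymp"
begin

section \<open>Lagrange weights and signed mixtures of exponential tilts\<close>

text \<open>The exponent of the theorem balances two demands on t. Extrapolating moments from [0,1]
  to Theta costs weights of size about (t Theta)^t; keeping them below a power of 1/eps forces t ln
  L = O(L). Each matched moment gains a factor Theta^2 rho in the correlation, where the overlap rho
  is a negative power of d. This gives d^(-Omega(t)).

  Nonnegativity of D_v is the obstacle. Nodes in [0,1] let the subtracted part grow at most like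
  exp(s), s = v.x. For s <= T it is tamed by beta, because T = o(L); beyond T the term at Theta
  outgrows it. Hiding the cut from d^(L / ln L) examples needs T^2 of order L^2 / ln L, which is
  still o(L^2), so both demands fit.

  Queries may depend on the sample and on earlier answers, and success events depend on v. So
  averaging first fixes one sample and seed that are good for most v; the run against Gaussian
  answers then fixes finitely many queries; only then is v chosen among the directions that none of
  them detects.\<close>

definition lagrange_basis :: "(nat \<Rightarrow> real) \<Rightarrow> nat \<Rightarrow> nat \<Rightarrow> real \<Rightarrow> real" where
  "lagrange_basis a t k z = (\<Prod>l\<in>{..t} - {k}. (z - a l) / (a k - a l))"

text \<open>As polynomials in \<open>z\<close>, both sides have degree at most \<open>t\<close> and
  agree at the \<open>t + 1\<close> distinct nodes.\<close>

lemma lagrange_basis_power: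
  assumes inj: "inj_on a {..t}" and j: "j \<le> t"
  shows "(\<Sum>k\<le>t. lagrange_basis a t k z * a k ^ j) = z ^ j"
proof -
  define b where
    "b k = (\<Prod>l\<in>{..t} - {k}. [:- a l / (a k - a l), 1 / (a k - a l):])" for k
  define p where "p = (\<Sum>k\<le>t. smult (a k ^ j) (b k))"
  have poly_b: "poly (b k) x = lagrange_basis a t k x" for k x
    by (auto simp: b_def lagrange_basis_def poly_prod diff_divide_distrib intro!: prod.cong)
  have deg_b: "degree (b k) \<le> t" if "k \<le> t" for k
  proof -
    have "degree (b k) \<le> sum (degree \<circ> (\<lambda>l. [:- a l / (a k - a l), 1 / (a k - a l):])) ({..t} - {k})"
      unfolding b_def by (rule degree_prod_sum_le) auto
    also have "\<dots> \<le> (\<Sum>l\<in>{..t} - {k}. 1)"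
      by (intro sum_mono) auto
    also have "\<dots> = t" using that by simp
    finally show ?thesis .
  qed
  have basis: "lagrange_basis a t k (a i) = (if i = k then 1 else 0)" if "i \<le> t" "k \<le> t" for i k
  proof (cases "i = k")
    case True
    then have "(a i - a l) / (a k - a l) = 1" if "l \<in> {..t} - {k}" for l
      using that inj \<open>k \<le> t\<close> by (auto dest: inj_onD)
    then show ?thesis using True by (simp add: lagrange_basis_def)
  next
    case False
    then show ?thesis using that by (auto simp: lagrange_basis_def)
  qed
  have "p = monom 1 j"
  proof (rule poly_eqI_degree[where A = "a ` {..t}"])
    fix x assume "x \<in> a ` {..t}"
    then obtain i where i: "i \<le> t" "x = a i" by auto
    have "poly p x = (\<Sum>k\<le>t. if k = i then a k ^ j else 0)"
      unfolding p_def poly_sum i by (intro sum.cong) (auto simp: poly_b basis i)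
    also have "\<dots> = x ^ j" using i by simp
    finally show "poly p x = poly (monom 1 j) x" by (simp add: poly_monom)
  next
    have "degree p \<le> t"
      unfolding p_def by (intro degree_sum_le) (auto simp: deg_b)
    then show "degree p < card (a ` {..t})" by (simp add: card_image[OF inj])
    show "degree (monom (1::real) j) < card (a ` {..t})"
      using j degree_monom_le[of "1::real" j] by (simp add: card_image[OF inj])
  qed
  then have "poly p z = z ^ j" by (simp add: poly_monom)
  then show ?thesis by (simp add: p_def poly_sum poly_b mult.commute)
qed

text \<open>The likelihood ratio of N(\<theta> v, I) to N(0, I) at a point with v.x =
  \<open>s\<close>, for a unit vector v; equivalently, the generating function of the Hermite
  polynomials.\<close>

definition tilt :: "real \<Rightarrow> real \<Rightarrow> real" where
  "tilt \<theta> s = exp (\<theta> * s - \<theta>\<^sup>2 / 2)"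

text \<open>Indices up to \<open>t\<close> are the interpolation nodes, equally spaced in [0,1]; the
  extra index \<open>Suc t\<close> carries the far point \<Theta>, so that a single sum holds the
  added Gaussian and its correction.\<close>

definition node :: "nat \<Rightarrow> real \<Rightarrow> nat \<Rightarrow> real" where
  "node t \<Theta> k = (if k \<le> t then real k / real t else \<Theta>)"

definition weight :: "nat \<Rightarrow> real \<Rightarrow> nat \<Rightarrow> real" where
  "weight t \<Theta> k = (if k \<le> t then - lagrange_basis (\<lambda>l. real l / real t) t k \<Theta> else 1)"

definition bump :: "nat \<Rightarrow> real \<Rightarrow> real \<Rightarrow> real" where
  "bump t \<Theta> s = (\<Sum>k\<le>Suc t. weight t \<Theta> k * tilt (node t \<Theta> k) s)"

lemma tilt_pos [simp]: "0 < tilt \<theta> s"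
  by (simp add: tilt_def)

lemma tilt_0 [simp]: "tilt 0 s = 1"
  by (simp add: tilt_def)

lemma tilt_measurable [measurable]: "tilt \<theta> \<in> borel_measurable borel"
  unfolding tilt_def[abs_def] by measurable

lemma bump_measurable [measurable]: "bump t \<Theta> \<in> borel_measurable borel"
  unfolding bump_def[abs_def] by measurable

text \<open>Interpolation at \<open>t + 1\<close> nodes extrapolates \<open>z ^ j\<close> to
  \<Theta> exactly, and the weight 1 at the far node cancels the result.\<close>

lemma weight_moments:
  assumes "t \<ge> 1" "j \<le> t"
  shows "(\<Sum>k\<le>Suc t. weight t \<Theta> k * node t \<Theta> k ^ j) = 0"
proof -
  have "(\<Sum>k\<le>t. weight t \<Theta> k * node t \<Theta> k ^ j) = - (\<Theta> ^ j)"
    using lagrange_basis_power[of "\<lambda>l. real l / real t" t j \<Theta>] assms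
    by (simp add: weight_def node_def sum_negf inj_on_def)
  then show ?thesis by (simp add: weight_def node_def)
qed

text \<open>Each weight is a product of \<open>t\<close> factors; a numerator is at most \<Theta>,
  and a denominator is at least the node spacing 1/t.\<close>

lemma sum_abs_weight_le:
  assumes "t \<ge> 1" "\<Theta> \<ge> 1"
  shows "(\<Sum>k\<le>t. \<bar>weight t \<Theta> k\<bar>) \<le> (real t + 1) * (real t * \<Theta>) ^ t"
proof -
  have "\<bar>weight t \<Theta> k\<bar> \<le> (real t * \<Theta>) ^ t" if k: "k \<le> t" for k
  proof -
    have "\<bar>weight t \<Theta> k\<bar> =
        (\<Prod>l\<in>{..t} - {k}. \<bar>(\<Theta> - real l / real t) / (real k / real t - real l / real t)\<bar>)"
      using k by (simp add: weight_def lagrange_basis_def abs_prod)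
    also have "\<dots> \<le> (\<Prod>l\<in>{..t} - {k}. real t * \<Theta>)"
    proof (intro prod_mono conjI abs_ge_zero)
      fix l assume l: "l \<in> {..t} - {k}"
      have num: "\<bar>\<Theta> - real l / real t\<bar> \<le> \<Theta>"
      proof -
        have "0 \<le> real l / real t" "real l / real t \<le> 1" using l assms by auto
        then show ?thesis using assms by linarith
      qed
      have "1 \<le> \<bar>real k - real l\<bar>" using l by auto
      then have den: "1 / real t \<le> \<bar>real k / real t - real l / real t\<bar>"
        using assms by (simp add: diff_divide_distrib[symmetric] divide_right_mono)
      have "\<bar>\<Theta> - real l / real t\<bar> / \<bar>real k / real t - real l / real t\<bar> \<le> \<Theta> / (1 / real t)"
        using num den assms by (intro frac_le) auto
      then show "\<bar>(\<Theta> - real l / real t) / (real k / real t - real l / real t)\<bar> \<le> real t * \<Theta>"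
        by (simp add: abs_divide mult.commute)
    qed
    also have "\<dots> = (real t * \<Theta>) ^ t" using k by simp
    finally show ?thesis .
  qed
  then have "(\<Sum>k\<le>t. \<bar>weight t \<Theta> k\<bar>) \<le> (\<Sum>k\<le>t. (real t * \<Theta>) ^ t)"
    by (intro sum_mono) auto
  then show ?thesis by (simp add: add.commute)
qed

text \<open>A node in [0,1] gives a tilt of at most \<open>exp (max s 0)\<close>. This is why the
  nodes are kept in [0,1]: the possible negative part has exponential rate 1 in \<open>s\<close>,
  against rate \<Theta> for the positive term.\<close>

lemma bump_ge:
  assumes "t \<ge> 1" "\<Theta> \<ge> 1"
  shows "bump t \<Theta> s \<ge> tilt \<Theta> s - (real t + 1) * (real t * \<Theta>) ^ t * exp (max s 0)"
proof -
  have "\<bar>\<Sum>k\<le>t. weight t \<Theta> k * tilt (node t \<Theta> k) s\<bar> \<le> (\<Sum>k\<le>t. \<bar>weight t \<Theta> k\<bar> * exp (max s 0))"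
  proof (intro order.trans[OF sum_abs] sum_mono)
    fix k assume "k \<in> {..t}"
    then have n: "0 \<le> node t \<Theta> k" "node t \<Theta> k \<le> 1" using assms by (auto simp: node_def)
    have "node t \<Theta> k * s \<le> node t \<Theta> k * max s 0" by (intro mult_left_mono n) auto
    also have "\<dots> \<le> 1 * max s 0" by (intro mult_right_mono n) auto
    finally have "node t \<Theta> k * s - (node t \<Theta> k)\<^sup>2 / 2 \<le> max s 0"
      using zero_le_power2[of "node t \<Theta> k"] by linarith
    then have "tilt (node t \<Theta> k) s \<le> exp (max s 0)" by (simp add: tilt_def)
    then show "\<bar>weight t \<Theta> k * tilt (node t \<Theta> k) s\<bar> \<le> \<bar>weight t \<Theta> k\<bar> * exp (max s 0)"
      by (simp add: abs_mult mult_left_mono less_imp_le)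
  qed
  also have "\<dots> = (\<Sum>k\<le>t. \<bar>weight t \<Theta> k\<bar>) * exp (max s 0)" by (simp add: sum_distrib_right)
  also have "\<dots> \<le> (real t + 1) * (real t * \<Theta>) ^ t * exp (max s 0)"
    by (intro mult_right_mono sum_abs_weight_le assms) auto
  finally show ?thesis by (simp add: bump_def weight_def node_def)
qed

section \<open>Correlation decay from vanishing moments\<close>

lemma exp_minus_Taylor_le:
  fixes z :: real
  shows "\<bar>exp z - (\<Sum>j<n. z ^ j / fact j)\<bar> \<le> \<bar>z\<bar> ^ n * exp \<bar>z\<bar>"
proof -
  obtain x where x: "\<bar>x\<bar> \<le> \<bar>z\<bar>" "exp z = (\<Sum>j<n. z ^ j / fact j) + exp x / fact n * z ^ n"
    using Maclaurin_exp_le[of z n] by blast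
  \<comment> \<open>The factorial is given away; only the order \<open>n\<close> of vanishing in
    \<open>z\<close> matters below.\<close>
  have "exp x / fact n \<le> exp x / 1"
    by (intro divide_left_mono) auto
  also have "exp x / 1 \<le> exp \<bar>z\<bar>" using x by auto
  finally have "\<bar>z\<bar> ^ n * (exp x / fact n) \<le> \<bar>z\<bar> ^ n * exp \<bar>z\<bar>" by (intro mult_left_mono) auto
  then show ?thesis using x by (simp add: abs_mult power_abs mult.commute)
qed

text \<open>Expand the kernel in powers of \<rho>: the coefficient of \<open>\<rho> ^ j\<close> is
  the square of the \<open>j\<close>-th moment over \<open>fact j\<close>, hence zero up to order
  \<open>t\<close>. Only Taylor remainders of order \<open>t + 1\<close> are left, and they are
  bounded entry by entry.\<close>

lemma abs_sum_exp_le_of_moments: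
  fixes w \<theta> :: "'a \<Rightarrow> real" and \<rho> \<Theta> :: real
  assumes mom: "\<And>j. j \<le> t \<Longrightarrow> (\<Sum>i\<in>I. w i * \<theta> i ^ j) = 0"
    and \<theta>: "\<And>i. i \<in> I \<Longrightarrow> \<bar>\<theta> i\<bar> \<le> \<Theta>"
  shows "\<bar>\<Sum>i\<in>I. \<Sum>k\<in>I. w i * w k * exp (\<theta> i * \<theta> k * \<rho>)\<bar>
           \<le> (\<Sum>i\<in>I. \<bar>w i\<bar>)\<^sup>2 * ((\<Theta>\<^sup>2 * \<bar>\<rho>\<bar>) ^ Suc t * exp (\<Theta>\<^sup>2 * \<bar>\<rho>\<bar>))"
proof -
  have square: "(\<Sum>i\<in>I. \<bar>w i\<bar>)\<^sup>2 = (\<Sum>i\<in>I. \<Sum>k\<in>I. \<bar>w i\<bar> * \<bar>w k\<bar>)"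
    by (simp only: power2_eq_square sum_product)
  define T where "T z = (\<Sum>j<Suc t. z ^ j / fact j)" for z :: real
  have "(\<Sum>i\<in>I. \<Sum>k\<in>I. w i * w k * T (\<theta> i * \<theta> k * \<rho>)) =
      (\<Sum>j<Suc t. \<rho> ^ j / fact j * ((\<Sum>i\<in>I. w i * \<theta> i ^ j) * (\<Sum>k\<in>I. w k * \<theta> k ^ j)))"
  proof -
    have "(\<Sum>i\<in>I. \<Sum>k\<in>I. w i * w k * T (\<theta> i * \<theta> k * \<rho>)) =
      (\<Sum>i\<in>I. \<Sum>k\<in>I. \<Sum>j<Suc t. \<rho> ^ j / fact j * (w i * \<theta> i ^ j * (w k * \<theta> k ^ j)))"
      by (simp only: T_def sum_distrib_left power_mult_distrib) (simp add: mult_ac)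
    also have "\<dots> = (\<Sum>i\<in>I. \<Sum>j<Suc t. \<Sum>k\<in>I. \<rho> ^ j / fact j * (w i * \<theta> i ^ j * (w k * \<theta> k ^ j)))"
      by (intro sum.cong refl sum.swap)
    also have "\<dots> = (\<Sum>j<Suc t. \<Sum>i\<in>I. \<Sum>k\<in>I. \<rho> ^ j / fact j * (w i * \<theta> i ^ j * (w k * \<theta> k ^ j)))"
      by (rule sum.swap)
    also have "\<dots> = (\<Sum>j<Suc t. \<rho> ^ j / fact j * ((\<Sum>i\<in>I. w i * \<theta> i ^ j) * (\<Sum>k\<in>I. w k * \<theta> k ^ j)))"
      by (intro sum.cong refl, subst sum_product) (simp only: sum_distrib_left)
    finally show ?thesis .
  qed
  also have "\<dots> = 0" by (intro sum.neutral) (auto simp: mom)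
  finally have "(\<Sum>i\<in>I. \<Sum>k\<in>I. w i * w k * exp (\<theta> i * \<theta> k * \<rho>)) =
      (\<Sum>i\<in>I. \<Sum>k\<in>I. w i * w k * (exp (\<theta> i * \<theta> k * \<rho>) - T (\<theta> i * \<theta> k * \<rho>)))"
    by (simp add: right_diff_distrib sum_subtractf)
  also have "\<bar>\<dots>\<bar> \<le> (\<Sum>i\<in>I. \<Sum>k\<in>I. \<bar>w i\<bar> * \<bar>w k\<bar> * ((\<Theta>\<^sup>2 * \<bar>\<rho>\<bar>) ^ Suc t * exp (\<Theta>\<^sup>2 * \<bar>\<rho>\<bar>)))"
  proof (intro order.trans[OF sum_abs] sum_mono)
    fix i k assume ik: "i \<in> I" "k \<in> I"
    have "\<bar>\<theta> i\<bar> * \<bar>\<theta> k\<bar> \<le> \<Theta> * \<Theta>"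
      using \<theta>[OF ik(1)] \<theta>[OF ik(2)] by (intro mult_mono) auto
    then have z: "\<bar>\<theta> i * \<theta> k * \<rho>\<bar> \<le> \<Theta>\<^sup>2 * \<bar>\<rho>\<bar>"
      by (simp add: abs_mult power2_eq_square mult_right_mono)
    have "\<bar>exp (\<theta> i * \<theta> k * \<rho>) - T (\<theta> i * \<theta> k * \<rho>)\<bar>
        \<le> \<bar>\<theta> i * \<theta> k * \<rho>\<bar> ^ Suc t * exp \<bar>\<theta> i * \<theta> k * \<rho>\<bar>"
      unfolding T_def by (rule exp_minus_Taylor_le)
    also have "\<dots> \<le> (\<Theta>\<^sup>2 * \<bar>\<rho>\<bar>) ^ Suc t * exp (\<Theta>\<^sup>2 * \<bar>\<rho>\<bar>)"
      using z by (intro mult_mono power_mono) auto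
    finally show "\<bar>w i * w k * (exp (\<theta> i * \<theta> k * \<rho>) - T (\<theta> i * \<theta> k * \<rho>))\<bar>
        \<le> \<bar>w i\<bar> * \<bar>w k\<bar> * ((\<Theta>\<^sup>2 * \<bar>\<rho>\<bar>) ^ Suc t * exp (\<Theta>\<^sup>2 * \<bar>\<rho>\<bar>))"
      by (auto simp only: abs_mult intro!: mult_left_mono mult_nonneg_nonneg abs_ge_zero)
  qed
  also have "\<dots> = (\<Sum>i\<in>I. \<bar>w i\<bar>)\<^sup>2 * ((\<Theta>\<^sup>2 * \<bar>\<rho>\<bar>) ^ Suc t * exp (\<Theta>\<^sup>2 * \<bar>\<rho>\<bar>))"
    by (simp only: square sum_distrib_right)
  finally show ?thesis .
qed

section \<open>Concentration of random sign vectors\<close>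

lemma cosh_le_exp_half_square: "cosh x \<le> exp (x\<^sup>2 / 2)" for x :: real
proof -
  have *: "cosh y \<le> exp (y\<^sup>2 / 2)" if "y \<ge> 0" for y :: real
  proof -
    \<comment> \<open>Hoeffding's lemma for a fair sign, with range \<open>2 * y\<close> and mean
      parameter 1/2. It is applied to nonnegative arguments; evenness of \<open>cosh\<close> covers
      the rest.\<close>
    have "ln (1 + 1 / 2 * (exp (2 * y) - 1)) \<le> y\<^sup>2 / 2 + y"
      using Hoeffdings_lemma_aux[of "2 * y" "1 / 2"] that by (simp add: power2_eq_square)
    moreover have pos: "1 + 1 / 2 * (exp (2 * y) - 1) = exp y * cosh y"
      by (simp add: cosh_def field_simps flip: exp_add)
    ultimately have "ln (exp y * cosh y) \<le> y\<^sup>2 / 2 + y" by simp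
    then have "exp y * cosh y \<le> exp (y\<^sup>2 / 2 + y)"
      by (metis cosh_real_pos exp_gt_zero exp_le_cancel_iff exp_ln mult_pos_pos)
    then show ?thesis by (simp add: exp_add mult.commute)
  qed
  show ?thesis using *[of x] *[of "- x"] by (cases "x \<ge> 0") auto
qed

lemma sum_signs_exp:
  assumes "finite J"
  shows "(\<Sum>\<sigma>\<in>PiE J (\<lambda>_. {-1, 1::real}). exp (\<Sum>i\<in>J. c i * \<sigma> i)) = (\<Prod>i\<in>J. 2 * cosh (c i))"
proof -
  have "(\<Prod>i\<in>J. 2 * cosh (c i)) = (\<Prod>i\<in>J. \<Sum>y\<in>{-1, 1}. exp (c i * y))"
    by (intro prod.cong) (auto simp: cosh_def)
  also have "\<dots> = (\<Sum>\<sigma>\<in>PiE J (\<lambda>_. {-1, 1::real}). exp (\<Sum>i\<in>J. c i * \<sigma> i))"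
    using assms by (subst prod_sum_PiE) (auto simp: exp_sum)
  finally show ?thesis by simp
qed

text \<open>Chernoff's bound for a uniform sign vector. Since
  \<open>cosh c \<le> exp (c\<^sup>2 / 2)\<close>, the best multiplier in the exponential moment is
  \<open>s\<close> itself. The one-sided bound is used for \<tau> and for its negative.\<close>

lemma card_signs_correlated_le:
  assumes J: "finite J" and \<tau>: "\<And>i. i \<in> J \<Longrightarrow> \<bar>\<tau> i\<bar> = 1" and s: "s \<ge> 0"
  defines "S \<equiv> PiE J (\<lambda>_. {-1, 1::real})"
  shows "real (card {\<sigma>\<in>S. \<bar>\<Sum>i\<in>J. \<sigma> i * \<tau> i\<bar> > s * real (card J)})
           \<le> 2 * exp (- (s\<^sup>2 * real (card J) / 2)) * real (card S)"
proof -
  have finS: "finite S" unfolding S_def using J by (intro finite_PiE) auto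
  have cardS: "card S = 2 ^ card J"
    unfolding S_def using J by (subst card_PiE) (auto simp: numeral_2_eq_2)
  have one_side: "real (card {\<sigma>\<in>S. (\<Sum>i\<in>J. \<sigma> i * u i) > s * real (card J)})
      \<le> exp (- (s\<^sup>2 * real (card J) / 2)) * real (card S)"
    if u: "\<And>i. i \<in> J \<Longrightarrow> \<bar>u i\<bar> = 1" for u
  proof -
    let ?B = "{\<sigma>\<in>S. (\<Sum>i\<in>J. \<sigma> i * u i) > s * real (card J)}"
    have "real (card ?B) * exp (s * (s * real (card J))) = (\<Sum>\<sigma>\<in>?B. exp (s * (s * real (card J))))"
      by simp
    also have "\<dots> \<le> (\<Sum>\<sigma>\<in>?B. exp (s * (\<Sum>i\<in>J. \<sigma> i * u i)))"
      using s by (intro sum_mono) (auto intro: mult_left_mono)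
    also have "\<dots> \<le> (\<Sum>\<sigma>\<in>S. exp (s * (\<Sum>i\<in>J. \<sigma> i * u i)))"
      by (intro sum_mono2 finS) auto
    also have "\<dots> = (\<Sum>\<sigma>\<in>S. exp (\<Sum>i\<in>J. (s * u i) * \<sigma> i))"
      by (simp add: sum_distrib_left mult_ac)
    also have "\<dots> = (\<Prod>i\<in>J. 2 * cosh (s * u i))"
      unfolding S_def by (rule sum_signs_exp[OF J])
    also have "\<dots> \<le> (\<Prod>i\<in>J. 2 * exp (s\<^sup>2 / 2))"
    proof (intro prod_mono conjI)
      fix i assume "i \<in> J"
      then have "(u i)\<^sup>2 = 1" using u[of i] by (simp add: power2_eq_1_iff abs_if split: if_splits)
      then show "2 * cosh (s * u i) \<le> 2 * exp (s\<^sup>2 / 2)"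
        using cosh_le_exp_half_square[of "s * u i"] by (simp add: power_mult_distrib)
    qed auto
    also have "\<dots> = real (card S) * exp (s\<^sup>2 * real (card J) / 2)"
      by (simp add: cardS power_mult_distrib exp_of_nat_mult[symmetric] mult_ac)
    finally have "real (card ?B) * exp (s * (s * real (card J))) \<le>
        (exp (- (s\<^sup>2 * real (card J) / 2)) * real (card S)) * exp (s * (s * real (card J)))"
      by (simp add: mult_ac power2_eq_square flip: exp_add)
    then show ?thesis by simp
  qed
  have sub: "{\<sigma>\<in>S. \<bar>\<Sum>i\<in>J. \<sigma> i * \<tau> i\<bar> > s * real (card J)} \<subseteq>
      {\<sigma>\<in>S. (\<Sum>i\<in>J. \<sigma> i * \<tau> i) > s * real (card J)} \<union>
      {\<sigma>\<in>S. (\<Sum>i\<in>J. \<sigma> i * (- \<tau> i)) > s * real (card J)}"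
    by (auto simp: sum_negf abs_if split: if_splits)
  have "card {\<sigma>\<in>S. \<bar>\<Sum>i\<in>J. \<sigma> i * \<tau> i\<bar> > s * real (card J)} \<le>
      card {\<sigma>\<in>S. (\<Sum>i\<in>J. \<sigma> i * \<tau> i) > s * real (card J)} +
      card {\<sigma>\<in>S. (\<Sum>i\<in>J. \<sigma> i * (- \<tau> i)) > s * real (card J)}"
    by (rule order.trans[OF card_mono[OF _ sub] card_Un_le]) (use finS in auto)
  then show ?thesis
    using one_side[OF \<tau>] one_side[of "\<lambda>i. - \<tau> i"] \<tau> by fastforce
qed

section \<open>Gaussian integrals\<close>

abbreviation std_normal :: "real measure" where
  "std_normal \<equiv> density lborel (\<lambda>t. ennreal (std_normal_density t))"

lemma prob_space_std_normal: "prob_space std_normal"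
  using prob_space_normal_density[of 1 0] by simp

text \<open>Completing the square turns the integrand into a constant times the normal density with
  mean \<open>c\<close>.\<close>

lemma has_bochner_integral_exp_std_normal:
  "has_bochner_integral std_normal (\<lambda>s. exp (c * s)) (exp (c\<^sup>2 / 2))"
proof -
  have eq: "std_normal_density s *\<^sub>R exp (c * s) = exp (c\<^sup>2 / 2) * normal_density c 1 s" for s
    by (simp add: normal_density_def power2_eq_square field_simps flip: exp_add)
  have "has_bochner_integral lborel (\<lambda>s. exp (c\<^sup>2 / 2) * normal_density c 1 s) (exp (c\<^sup>2 / 2) * 1)"
    by (intro has_bochner_integral_mult_right) (simp add: has_bochner_integral_iff)
  then show ?thesis
    by (intro has_bochner_integral_density) (simp_all only: eq, simp_all)
qed

lemma has_bochner_integral_std_normal_nonneg: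
  "has_bochner_integral std_normal (\<lambda>s. indicator {0..} s :: real) (1 / 2)"
proof -
  define a where "a = (\<integral>s. indicator {0..} s *\<^sub>R std_normal_density s \<partial>lborel)"
  have h: "has_bochner_integral lborel (\<lambda>s. indicator {0..} s *\<^sub>R std_normal_density s) a"
    unfolding a_def by (intro has_bochner_integral_integrable integrable_mult_indicator) auto
  then have "has_bochner_integral lborel std_normal_density (2 *\<^sub>R a)"
    by (rule has_bochner_integral_even_function) (simp add: std_normal_density_def)
  then have "2 *\<^sub>R a = 1"
    using integral_normal_density[of 1 0] by (auto simp: has_bochner_integral_iff)
  then have "a = 1 / 2" by simp
  with h show ?thesis
    by (intro has_bochner_integral_density) (simp_all add: mult.commute)
qed

interpretation std_normal: prob_space std_normal
  by (rule prob_space_std_normal)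

interpretation std_normal_power: product_prob_space "\<lambda>_::nat. std_normal" UNIV
  by standard

lemma prob_space_std_gaussian: "prob_space (std_gaussian d)"
  unfolding std_gaussian_def by (intro prob_space_PiM prob_space_std_normal)

lemma sets_std_gaussian [simp, measurable_cong]: "sets (std_gaussian d) = sets (borel_space d)"
  unfolding std_gaussian_def by (intro sets_PiM_cong) auto

lemma space_std_gaussian [simp]: "space (std_gaussian d) = space (borel_space d)"
  by (rule sets_eq_imp_space_eq) simp

lemma has_bochner_integral_std_gaussian_prod:
  assumes "\<And>i. i < d \<Longrightarrow> has_bochner_integral std_normal (f i) (a i :: real)"
  shows "has_bochner_integral (std_gaussian d) (\<lambda>x. \<Prod>i<d. f i (x i)) (\<Prod>i<d. a i)"
proof -
  have f: "integrable std_normal (f i)" "integral\<^sup>L std_normal (f i) = a i" if "i \<in> {..<d}" for i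
    using assms[of i] that by (auto simp: has_bochner_integral_iff)
  have "(\<integral>x. (\<Prod>i<d. f i (x i)) \<partial>std_gaussian d) = (\<Prod>i<d. integral\<^sup>L std_normal (f i))"
    unfolding std_gaussian_def by (intro std_normal_power.product_integral_prod f) auto
  moreover have "integrable (std_gaussian d) (\<lambda>x. \<Prod>i<d. f i (x i))"
    unfolding std_gaussian_def by (intro std_normal_power.product_integrable_prod f) auto
  ultimately show ?thesis by (simp add: has_bochner_integral_iff f)
qed

lemma dot_measurable [measurable]: "dot d w \<in> borel_measurable (borel_space d)"
  unfolding dot_def[abs_def] by measurable

lemma has_bochner_integral_exp_dot:
  "has_bochner_integral (std_gaussian d) (\<lambda>x. exp (dot d w x)) (exp (dot d w w / 2))"
  using has_bochner_integral_std_gaussian_prod[OF has_bochner_integral_exp_std_normal, of d w]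
  by (simp add: dot_def exp_sum sum_divide_distrib power2_eq_square)

text \<open>Because \<open>w\<close> has no component along coordinate 0, the integrand is a product
  over the coordinates, and coordinate 0 contributes the factor 1/2. The known halfspace is thus
  independent of every hidden direction.\<close>

lemma has_bochner_integral_exp_dot_nonneg_coordinate:
  assumes "0 < d" "w 0 = 0"
  shows "has_bochner_integral (std_gaussian d)
    (\<lambda>x. indicator {0..} (x 0) * exp (dot d w x)) (exp (dot d w w / 2) / 2)"
proof -
  define f where "f i = (if i = 0 then indicator {0..} else (\<lambda>s. exp (w i * s)))" for i
  have split: "{..<d} = insert 0 {1..<d}" using assms by auto
  have "has_bochner_integral (std_gaussian d) (\<lambda>x. \<Prod>i<d. f i (x i))
      (\<Prod>i<d. if i = 0 then 1 / 2 else exp ((w i)\<^sup>2 / 2))"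
    using has_bochner_integral_exp_std_normal has_bochner_integral_std_normal_nonneg
    by (intro has_bochner_integral_std_gaussian_prod) (auto simp: f_def)
  moreover have "(\<Prod>i<d. f i (x i)) = indicator {0..} (x 0) * exp (dot d w x)" for x
    unfolding dot_def split using assms by (auto simp: f_def exp_sum intro!: prod.cong)
  moreover have "(\<Prod>i<d. if i = 0 then 1 / 2 else exp ((w i)\<^sup>2 / 2)) = exp (dot d w w / 2) / 2"
    unfolding dot_def split using assms
    by (auto simp: exp_sum sum_divide_distrib power2_eq_square intro!: prod.cong)
  ultimately show ?thesis by simp
qed

lemma dot_linear:
  "dot d (\<lambda>i. a * u i + b * v i) x = a * dot d u x + b * dot d v x"
  by (simp add: dot_def sum.distrib sum_distrib_left algebra_simps)

lemma dot_commute: "dot d u v = dot d v u"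
  by (simp add: dot_def mult.commute)

text \<open>Up to a constant the product is one exponential in \<open>a u + b v\<close>. The
  normalisations cancel the squares in the norm of that vector and leave only the cross
  term.\<close>

lemma has_bochner_integral_tilt_mult:
  assumes "dot d u u = 1" "dot d v v = 1"
  shows "has_bochner_integral (std_gaussian d) (\<lambda>x. tilt a (dot d u x) * tilt b (dot d v x))
    (exp (a * b * dot d u v))"
proof -
  define w where "w = (\<lambda>i. a * u i + b * v i)"
  have "dot d w w = a * dot d u w + b * dot d v w"
    by (simp add: w_def dot_linear)
  also have "dot d u w = a * dot d u u + b * dot d v u"
    by (subst dot_commute) (simp add: w_def dot_linear)
  also have "dot d v w = a * dot d u v + b * dot d v v"
    by (subst dot_commute) (simp add: w_def dot_linear)
  finally have ww: "dot d w w = a\<^sup>2 + b\<^sup>2 + 2 * a * b * dot d u v"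
    using assms by (simp add: dot_commute[of d v u] power2_eq_square algebra_simps)
  have "tilt a (dot d u x) * tilt b (dot d v x) = exp (- (a\<^sup>2 + b\<^sup>2) / 2) * exp (dot d w x)" for x
    by (simp add: tilt_def w_def dot_linear field_simps flip: exp_add)
  moreover have "exp (- (a\<^sup>2 + b\<^sup>2) / 2) * exp (dot d w w / 2) = exp (a * b * dot d u v)"
    by (simp add: ww field_simps flip: exp_add)
  ultimately show ?thesis
    using has_bochner_integral_mult_right[OF has_bochner_integral_exp_dot[of d w],
        of "exp (- (a\<^sup>2 + b\<^sup>2) / 2)"] by simp
qed

lemma has_bochner_integral_tilt:
  assumes "dot d v v = 1"
  shows "has_bochner_integral (std_gaussian d) (\<lambda>x. tilt a (dot d v x)) 1"
  using has_bochner_integral_tilt_mult[OF assms assms, of a 0] by simp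

text \<open>Markov's inequality for the tilt at \<open>s\<close>, which is the optimal Chernoff
  exponent.\<close>

lemma std_gaussian_tail_le:
  assumes v: "dot d v v = 1" and "s \<ge> 0"
  shows "measure (std_gaussian d) {x \<in> space (borel_space d). dot d v x > s} \<le> exp (- (s\<^sup>2 / 2))"
proof -
  interpret prob_space "std_gaussian d" by (rule prob_space_std_gaussian)
  let ?A = "{x \<in> space (borel_space d). dot d v x > s}"
  have A: "?A \<in> sets (std_gaussian d)" by measurable
  have "measure (std_gaussian d) ?A = (\<integral>x. indicator ?A x \<partial>std_gaussian d)" 
    using A by simp
  also have "\<dots> \<le> (\<integral>x. exp (- (s\<^sup>2 / 2)) * tilt s (dot d v x) \<partial>std_gaussian d)"
  proof (rule integral_mono)
    show "integrable (std_gaussian d) (\<lambda>x. exp (- (s\<^sup>2 / 2)) * tilt s (dot d v x))"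
      using has_bochner_integral_tilt[OF v] by (auto simp: has_bochner_integral_iff)
    show "integrable (std_gaussian d) (indicator ?A :: _ \<Rightarrow> real)"
      using A by (auto simp: less_top[symmetric])
    fix x
    have "1 \<le> exp (- (s\<^sup>2 / 2)) * tilt s (dot d v x)" if "dot d v x > s"
    proof -
      have "s * s \<le> s * dot d v x" using that \<open>s \<ge> 0\<close> by (intro mult_left_mono) auto
      then show ?thesis by (simp add: tilt_def power2_eq_square flip: exp_add)
    qed
    then show "indicator ?A x \<le> exp (- (s\<^sup>2 / 2)) * tilt s (dot d v x)"
      by (auto simp: indicator_def less_imp_le)
  qed
  also have "\<dots> = exp (- (s\<^sup>2 / 2))"
    using has_bochner_integral_tilt[OF v, of s] by (simp add: has_bochner_integral_iff)
  finally show ?thesis .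
qed

text \<open>
  Under the density \<open>tilt \<Theta> (dot d v x)\<close> the vector is Gaussian with mean \<open>\<Theta> v\<close>, so the half-line
  above \<open>\<Theta> - 2\<close> carries most of the mass.
\<close>

lemma integral_tilt_upper_ge:
  fixes \<Theta> :: real
  assumes d: "0 < d" and v: "dot d v v = 1" "v 0 = 0"
  defines "E \<equiv> {x \<in> space (borel_space d). x 0 \<ge> 0 \<and> dot d v x > \<Theta> - 2}"
  shows "(\<integral>x. indicator E x * tilt \<Theta> (dot d v x) \<partial>std_gaussian d) \<ge> 1 / 2 - exp (- 2)"
proof -
  define w where "w = (\<lambda>i. \<Theta> * v i)"
  have w: "dot d w x = \<Theta> * dot d v x" for x
    by (simp add: w_def dot_def sum_distrib_left mult_ac)
  have ww: "dot d w w = \<Theta>\<^sup>2"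
    using v by (simp add: w dot_commute[of d v w] power2_eq_square)
  have half: "has_bochner_integral (std_gaussian d)
      (\<lambda>x. indicator {0..} (x 0) * tilt \<Theta> (dot d v x)) (1 / 2)"
  proof -
    have "has_bochner_integral (std_gaussian d)
      (\<lambda>x. exp (- (\<Theta>\<^sup>2 / 2)) * (indicator {0..} (x 0) * exp (dot d w x)))
      (exp (- (\<Theta>\<^sup>2 / 2)) * (exp (dot d w w / 2) / 2))"
      by (intro has_bochner_integral_mult_right has_bochner_integral_exp_dot_nonneg_coordinate d)
        (simp add: w_def v)
    moreover have "exp (- (\<Theta>\<^sup>2 / 2)) * (exp (dot d w w / 2) / 2) = 1 / 2"
      by (simp add: ww flip: exp_add)
    moreover have "exp (- (\<Theta>\<^sup>2 / 2)) * (indicator {0..} (x 0) * exp (dot d w x)) =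
        indicator {0..} (x 0) * tilt \<Theta> (dot d v x)" for x
    proof -
      have "exp (- (\<Theta>\<^sup>2 / 2)) * exp (dot d w x) = tilt \<Theta> (dot d v x)"
        by (simp add: tilt_def w flip: exp_add)
      then show ?thesis by (metis mult.left_commute)
    qed
    ultimately show ?thesis by simp
  qed
  \<comment> \<open>Chernoff's bound two standard deviations below the mean \<Theta>: where
    \<open>dot d v x \<le> \<Theta> - 2\<close>, the tilt at \<Theta> is at most
    \<open>exp (- 2)\<close> times the tilt at \<open>\<Theta> - 2\<close>, with equality on the
    boundary. Hence the offset 2 between T and \<Theta>, and the loss
    \<open>exp (- 2)\<close>.\<close>
  have lower: "has_bochner_integral (std_gaussian d)
      (\<lambda>x. exp (- 2) * tilt (\<Theta> - 2) (dot d v x)) (exp (- 2) * 1)"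
    by (intro has_bochner_integral_mult_right has_bochner_integral_tilt v)
  have "1 / 2 - exp (- 2) = (\<integral>x. indicator {0..} (x 0) * tilt \<Theta> (dot d v x) -
      exp (- 2) * tilt (\<Theta> - 2) (dot d v x) \<partial>std_gaussian d)"
    using has_bochner_integral_diff[OF half lower] by (simp add: has_bochner_integral_iff)
  also have "\<dots> \<le> (\<integral>x. indicator E x * tilt \<Theta> (dot d v x) \<partial>std_gaussian d)"
  proof (rule integral_mono)
    show "integrable (std_gaussian d) (\<lambda>x. indicator {0..} (x 0) * tilt \<Theta> (dot d v x) -
      exp (- 2) * tilt (\<Theta> - 2) (dot d v x))"
      using has_bochner_integral_diff[OF half lower] by (simp add: has_bochner_integral_iff)
    have m0[measurable]: "(\<lambda>x. x 0) \<in> borel_measurable (borel_space d)"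
      using d by (intro measurable_component_singleton) auto
    have E: "E \<in> sets (std_gaussian d)" unfolding E_def by measurable
    show "integrable (std_gaussian d) (\<lambda>x. indicator E x * tilt \<Theta> (dot d v x))"
      using integrable_mult_indicator[OF E, of "\<lambda>x. tilt \<Theta> (dot d v x)"]
        has_bochner_integral_tilt[OF v(1), of \<Theta>] by (simp add: has_bochner_integral_iff)
    fix x assume x: "x \<in> space (std_gaussian d)"
    have "tilt \<Theta> (dot d v x) \<le> exp (- 2) * tilt (\<Theta> - 2) (dot d v x)" if "dot d v x \<le> \<Theta> - 2"
      using that by (simp add: tilt_def power2_eq_square field_simps flip: exp_add)
    then show "indicator {0..} (x 0) * tilt \<Theta> (dot d v x) - exp (- 2) * tilt (\<Theta> - 2) (dot d v x)
        \<le> indicator E x * tilt \<Theta> (dot d v x)"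
      using x by (auto simp: E_def indicator_def less_imp_le)
  qed
  finally show ?thesis .
qed

lemma measure_std_gaussian_nonneg_coordinate:
  assumes "0 < d"
  shows "measure (std_gaussian d) {x \<in> space (borel_space d). x 0 \<ge> 0} = 1 / 2"
proof -
  have [measurable]: "(\<lambda>x. x 0) \<in> borel_measurable (borel_space d)"
    using assms by (intro measurable_component_singleton) auto
  let ?A = "{x \<in> space (borel_space d). x 0 \<ge> 0}"
  have A: "?A \<in> sets (std_gaussian d)" by measurable
  have "measure (std_gaussian d) ?A = (\<integral>x. indicator ?A x \<partial>std_gaussian d)"
    using A by simp
  also have "\<dots> = (\<integral>x. indicator {0..} (x 0) * exp (dot d (\<lambda>_. 0) x) \<partial>std_gaussian d)"
    by (intro Bochner_Integration.integral_cong) (auto simp: indicator_def dot_def)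
  also have "\<dots> = 1 / 2"
    using has_bochner_integral_exp_dot_nonneg_coordinate[OF assms, of "\<lambda>_. 0"]
    by (simp add: has_bochner_integral_iff dot_def)
  finally show ?thesis .
qed

section \<open>Statistical queries\<close>

text \<open>The standard bound behind statistical query dimension. Weighting each \<open>H i\<close>
  by the sign of its correlation with \<open>q\<close> gives one function \<open>h\<close> whose
  correlation with \<open>q\<close> is at least \<open>card B * \<phi>\<close>; as \<open>q\<close>
  is bounded by 1, the second moment of \<open>h\<close> is at least the square of this.\<close>

lemma (in prob_space) card_correlated_le:
  fixes H :: "'i \<Rightarrow> 'a \<Rightarrow> real"
  assumes B: "finite B"
    and q: "q \<in> borel_measurable M" "\<And>x. x \<in> space M \<Longrightarrow> \<bar>q x\<bar> \<le> 1"
    and int: "\<And>i. i \<in> B \<Longrightarrow> integrable M (H i)"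
    and int2: "\<And>i j. i \<in> B \<Longrightarrow> j \<in> B \<Longrightarrow> integrable M (\<lambda>x. H i x * H j x)"
    and large: "\<And>i. i \<in> B \<Longrightarrow> \<bar>\<integral>x. q x * H i x \<partial>M\<bar> \<ge> \<phi>"
    and "\<phi> > 0"
  shows "(real (card B) * \<phi>)\<^sup>2 \<le> (\<Sum>i\<in>B. \<Sum>j\<in>B. \<bar>\<integral>x. H i x * H j x \<partial>M\<bar>)"
proof (cases "B = {}")
  case False
  define c where "c i = sgn (\<integral>x. q x * H i x \<partial>M)" for i
  define h where "h x = (\<Sum>i\<in>B. c i * H i x)" for x
  define s where "s = real (card B) * \<phi>"
  have s: "s > 0" using False B \<open>\<phi> > 0\<close> by (simp add: s_def card_gt_0_iff)
  have c: "\<bar>c i\<bar> \<le> 1" for i by (simp add: c_def sgn_if)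
  have intq: "integrable M (\<lambda>x. q x * H i x)" if "i \<in> B" for i
    using q int[OF that]
    by (intro Bochner_Integration.integrable_bound[OF int[OF that]])
      (auto simp: abs_mult intro!: AE_I2 mult_left_le_one_le)
  have h2: "(h x)\<^sup>2 = (\<Sum>i\<in>B. \<Sum>j\<in>B. c i * c j * (H i x * H j x))" for x
    by (simp add: h_def power2_eq_square sum_product mult_ac)
  have int_h2: "integrable M (\<lambda>x. (h x)\<^sup>2)"
    unfolding h2 using int2 by (intro Bochner_Integration.integrable_sum integrable_mult_right) auto
  have qh: "q x * h x = (\<Sum>i\<in>B. c i * (q x * H i x))" for x
    by (simp add: h_def sum_distrib_left mult_ac)
  have int_qh: "integrable M (\<lambda>x. q x * h x)"
    unfolding qh using intq by (intro Bochner_Integration.integrable_sum integrable_mult_right) auto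
  have "s \<le> (\<Sum>i\<in>B. c i * (\<integral>x. q x * H i x \<partial>M))"
  proof -
    have "s = (\<Sum>i\<in>B. \<phi>)" by (simp add: s_def)
    also have "\<dots> \<le> (\<Sum>i\<in>B. c i * (\<integral>x. q x * H i x \<partial>M))"
      using large by (intro sum_mono) (simp add: c_def abs_sgn[symmetric] mult.commute)
    finally show ?thesis .
  qed
  also have "\<dots> = (\<integral>x. q x * h x \<partial>M)"
    unfolding qh using intq by (subst Bochner_Integration.integral_sum) auto
  \<comment> \<open>AM-GM tuned to \<open>s\<close> replaces Cauchy-Schwarz: the term
    \<open>s / 2\<close> is absorbed on the left, and \<open>s\<^sup>2\<close> is bounded by the
    second moment of \<open>h\<close>.\<close>
  also have "\<dots> \<le> (\<integral>x. s / 2 + (h x)\<^sup>2 / (2 * s) \<partial>M)"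
  proof (rule integral_mono)
    fix x assume "x \<in> space M"
    then have "q x * h x \<le> \<bar>h x\<bar>"
      using q(2)[of x] by (metis abs_ge_self abs_ge_zero abs_mult mult_left_le_one_le order.trans)
    also have "\<dots> \<le> s / 2 + (h x)\<^sup>2 / (2 * s)"
    proof -
      have "0 \<le> (s - \<bar>h x\<bar>)\<^sup>2 / (2 * s)" using s by simp
      also have "\<dots> = s / 2 + (h x)\<^sup>2 / (2 * s) - \<bar>h x\<bar>"
        using s by (simp add: power2_eq_square field_simps)
      finally show ?thesis by simp
    qed
    finally show "q x * h x \<le> s / 2 + (h x)\<^sup>2 / (2 * s)" .
  qed (use int_qh int_h2 in auto)
  also have "\<dots> = s / 2 + (\<integral>x. (h x)\<^sup>2 \<partial>M) / (2 * s)"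
    using int_h2 by (simp add: prob_space)
  finally have "s\<^sup>2 \<le> (\<integral>x. (h x)\<^sup>2 \<partial>M)"
    using s by (simp add: power2_eq_square field_simps)
  also have "\<dots> = (\<Sum>i\<in>B. \<Sum>j\<in>B. c i * c j * (\<integral>x. H i x * H j x \<partial>M))"
    unfolding h2 using int2
    by (subst Bochner_Integration.integral_sum, auto intro!: sum.cong)
  also have "\<dots> \<le> (\<Sum>i\<in>B. \<Sum>j\<in>B. \<bar>\<integral>x. H i x * H j x \<partial>M\<bar>)"
  proof (intro sum_mono)
    fix i j
    have "c i * c j * (\<integral>x. H i x * H j x \<partial>M) \<le> \<bar>c i * c j\<bar> * \<bar>\<integral>x. H i x * H j x \<partial>M\<bar>"
      by (metis abs_ge_self abs_mult)
    also have "\<dots> \<le> \<bar>\<integral>x. H i x * H j x \<partial>M\<bar>"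
      using c by (intro mult_left_le_one_le) (auto simp: abs_mult intro: mult_le_one)
    finally show "c i * c j * (\<integral>x. H i x * H j x \<partial>M) \<le> \<bar>\<integral>x. H i x * H j x \<partial>M\<bar>" .
  qed
  finally show ?thesis unfolding s_def .
qed simp

text \<open>Split each row of the double sum. Pairs outside \<open>P\<close> cost \<kappa> each and
  use up at most half of the left side, since \<open>2 * \<kappa> \<le> \<phi>\<^sup>2\<close>.
  Pairs in \<open>P\<close> may cost \<nu>, but a row has few of them, already when counted over all
  of \<open>S\<close>.\<close>

lemma (in prob_space) card_correlated_le_of_sparse:
  fixes H :: "'i \<Rightarrow> 'a \<Rightarrow> real"
  assumes S: "finite S" "B \<subseteq> S"
    and q: "q \<in> borel_measurable M" "\<And>x. x \<in> space M \<Longrightarrow> \<bar>q x\<bar> \<le> 1"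
    and int: "\<And>i. i \<in> S \<Longrightarrow> integrable M (H i)"
    and int2: "\<And>i j. i \<in> S \<Longrightarrow> j \<in> S \<Longrightarrow> integrable M (\<lambda>x. H i x * H j x)"
    and large: "\<And>i. i \<in> B \<Longrightarrow> \<bar>\<integral>x. q x * H i x \<partial>M\<bar> \<ge> \<phi>"
    and weak: "\<And>i j. i \<in> S \<Longrightarrow> j \<in> S \<Longrightarrow> \<not> P i j \<Longrightarrow> \<bar>\<integral>x. H i x * H j x \<partial>M\<bar> \<le> \<kappa>"
    and strong: "\<And>i j. i \<in> S \<Longrightarrow> j \<in> S \<Longrightarrow> \<bar>\<integral>x. H i x * H j x \<partial>M\<bar> \<le> \<nu>"
    and sparse: "\<And>i. i \<in> S \<Longrightarrow> real (card {j\<in>S. P i j}) \<le> \<gamma> * real (card S)"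
    and "\<phi> > 0" "2 * \<kappa> \<le> \<phi>\<^sup>2" "\<kappa> \<ge> 0" "\<nu> \<ge> 0"
  shows "real (card B) * \<phi>\<^sup>2 \<le> 2 * \<gamma> * \<nu> * real (card S)"
proof (cases "B = {}")
  case True
  show ?thesis
  proof (cases "S = {}")
    case False
    then obtain i where "i \<in> S" by auto
    \<comment> \<open>No sign of \<gamma> is assumed; a cardinality bounded by
      \<open>\<gamma> * real (card S)\<close> supplies it.\<close>
    then have "0 \<le> \<gamma> * real (card S)" using sparse[of i] by (meson of_nat_0_le_iff order.trans)
    then have "0 \<le> \<nu> * (\<gamma> * real (card S))" using \<open>\<nu> \<ge> 0\<close> by (rule mult_nonneg_nonneg[rotated])
    then show ?thesis using True by (simp add: mult_ac)
  qed (use True in simp)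
next
  case False
  have B: "finite B" using S by (rule finite_subset[rotated])
  have "(real (card B) * \<phi>)\<^sup>2 \<le> (\<Sum>i\<in>B. \<Sum>j\<in>B. \<bar>\<integral>x. H i x * H j x \<partial>M\<bar>)"
    using S by (intro card_correlated_le[OF B q int int2 large \<open>\<phi> > 0\<close>]) auto
  also have "\<dots> \<le> (\<Sum>i\<in>B. real (card B) * \<kappa> + \<gamma> * real (card S) * \<nu>)"
  proof (intro sum_mono)
    fix i assume i: "i \<in> B"
    have "(\<Sum>j\<in>B. \<bar>\<integral>x. H i x * H j x \<partial>M\<bar>) \<le> (\<Sum>j\<in>B. \<kappa> + (if P i j then \<nu> else 0))"
    proof (intro sum_mono)
      fix j assume "j \<in> B"
      then have "i \<in> S" "j \<in> S" using i S by auto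
      then show "\<bar>\<integral>x. H i x * H j x \<partial>M\<bar> \<le> \<kappa> + (if P i j then \<nu> else 0)"
        using weak[of i j] strong[of i j] \<open>\<kappa> \<ge> 0\<close> by (cases "P i j") simp_all
    qed
    also have "\<dots> = real (card B) * \<kappa> + real (card {j\<in>B. P i j}) * \<nu>"
      using B by (simp add: sum.distrib sum.If_cases Int_def)
    also have "real (card {j\<in>B. P i j}) \<le> real (card {j\<in>S. P i j})"
      using S by (intro of_nat_mono card_mono) auto
    also have "\<dots> \<le> \<gamma> * real (card S)" using i S by (intro sparse) auto
    finally show "(\<Sum>j\<in>B. \<bar>\<integral>x. H i x * H j x \<partial>M\<bar>) \<le> real (card B) * \<kappa> + \<gamma> * real (card S) * \<nu>"
      using \<open>\<nu> \<ge> 0\<close> by (simp add: mult_right_mono)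
  qed
  also have "\<dots> = real (card B) * (real (card B) * \<kappa> + \<gamma> * real (card S) * \<nu>)" by simp
  finally have "real (card B) * (real (card B) * \<phi>\<^sup>2) \<le>
      real (card B) * (real (card B) * \<kappa> + \<gamma> * real (card S) * \<nu>)"
    by (simp add: power2_eq_square mult_ac)
  moreover have "real (card B) > 0" using False B by (simp add: card_gt_0_iff)
  ultimately have "real (card B) * \<phi>\<^sup>2 \<le> real (card B) * \<kappa> + \<gamma> * real (card S) * \<nu>"
    by (rule mult_left_le_imp_le)
  moreover have "real (card B) * (2 * \<kappa>) \<le> real (card B) * \<phi>\<^sup>2"
    using \<open>2 * \<kappa> \<le> \<phi>\<^sup>2\<close> by (intro mult_left_mono) auto
  ultimately show ?thesis by (simp add: algebra_simps)
qed

section \<open>Query trees, training samples and averaging\<close>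

lemma run_determined_by_few_queries:
  assumes "at_most_queries d n a"
  shows "\<exists>Q. finite Q \<and> card Q \<le> n \<and> Q \<subseteq> sq_queries d \<and>
    (\<forall>orc'. (\<forall>q\<in>Q. orc' q = orc q) \<longrightarrow> run orc' a = run orc a)"
  using assms
proof (induction)
  case (3 q n k)
  \<comment> \<open>Only the child at the answer \<open>orc q\<close> is followed. So one query is
    added per level, although the tree branches over all reals, and another oracle that agrees on
    these queries takes the same path.\<close>
  then obtain Q where Q: "finite Q" "card Q \<le> n" "Q \<subseteq> sq_queries d"
    "\<And>orc'. (\<forall>q\<in>Q. orc' q = orc q) \<Longrightarrow> run orc' (k (orc q)) = run orc (k (orc q))"
    by meson
  have "card (insert q Q) \<le> Suc n" using Q(1,2) by (simp add: card_insert_if)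
  moreover have "insert q Q \<subseteq> sq_queries d" using Q(3) 3(1) by simp
  moreover have "run orc' (Query q k) = run orc (Query q k)" if "\<forall>p\<in>insert q Q. orc' p = orc p" for orc'
    using that Q(4)[of orc'] by simp
  ultimately show ?case using Q(1) by (meson finite_insert)
qed (auto intro!: exI[of _ "{}"])

lemma run_in_hypotheses:
  assumes "at_most_queries d n a" "run orc a = Some h"
  shows "h \<in> hypotheses d"
  using assms by (induction) auto

text \<open>A union bound over the examples, each of which has the Gaussian law under the joint law
  of sample and seed.\<close>

lemma sample_disagreement_le:
  fixes m :: nat and f g :: "point \<Rightarrow> real"
  assumes R: "prob_space R"
    and f: "f \<in> borel_measurable (borel_space d)" "g \<in> borel_measurable (borel_space d)"
    and \<eta>: "measure (std_gaussian d) {x \<in> space (borel_space d). f x \<noteq> g x} \<le> \<eta>"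
  defines "\<Omega> \<equiv> PiM {..<m} (\<lambda>_. std_gaussian d) \<Otimes>\<^sub>M R"
  shows "{\<omega>\<in>space \<Omega>. \<exists>k<m. f (fst \<omega> k) \<noteq> g (fst \<omega> k)} \<in> sets \<Omega>"
    "measure \<Omega> {\<omega>\<in>space \<Omega>. \<exists>k<m. f (fst \<omega> k) \<noteq> g (fst \<omega> k)} \<le> real m * \<eta>"
proof -
  interpret R: prob_space R by fact
  let ?P = "PiM {..<m} (\<lambda>_. std_gaussian d)"
  have P: "prob_space ?P" by (intro prob_space_PiM prob_space_std_gaussian)
  have \<Omega>: "prob_space \<Omega>" unfolding \<Omega>_def by (intro prob_space_pair P R)
  let ?D = "{x \<in> space (std_gaussian d). f x \<noteq> g x}"
  let ?E = "\<lambda>k. {\<omega>\<in>space \<Omega>. f (fst \<omega> k) \<noteq> g (fst \<omega> k)}"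
  have D: "?D \<in> sets (std_gaussian d)"
    using borel_measurable_neq[OF f] by simp
  have comp: "(\<lambda>\<omega>. fst \<omega> k) \<in> measurable \<Omega> (std_gaussian d)" if "k < m" for k
    unfolding \<Omega>_def using that
    by (intro measurable_compose[OF measurable_fst] measurable_component_singleton) auto
  have vim: "?E k = (\<lambda>\<omega>. fst \<omega> k) -` ?D \<inter> space \<Omega>" if "k < m" for k
    using measurable_space[OF comp[OF that]] by auto
  have E: "?E k \<in> sets \<Omega>" if "k < m" for k
    unfolding vim[OF that] by (rule measurable_sets[OF comp[OF that] D])
  have dist: "distr \<Omega> (std_gaussian d) (\<lambda>\<omega>. fst \<omega> k) = std_gaussian d" if "k < m" for k
  proof -
    have "distr \<Omega> (std_gaussian d) ((\<lambda>X. X k) \<circ> fst) =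
        distr (distr \<Omega> ?P fst) (std_gaussian d) (\<lambda>X. X k)"
      unfolding \<Omega>_def using that by (intro distr_distr[symmetric]) auto
    also have "\<dots> = distr ?P (std_gaussian d) (\<lambda>X. X k)"
      unfolding \<Omega>_def by (simp add: R.distr_pair_fst)
    also have "\<dots> = std_gaussian d"
      using that by (intro distr_PiM_component prob_space_std_gaussian) auto
    finally show ?thesis by (simp add: o_def)
  qed
  have meas: "measure \<Omega> (?E k) \<le> \<eta>" if "k < m" for k
  proof -
    have "measure \<Omega> (?E k) = measure (distr \<Omega> (std_gaussian d) (\<lambda>\<omega>. fst \<omega> k)) ?D"
      unfolding vim[OF that] by (rule measure_distr[OF comp[OF that] D, symmetric])
    then show ?thesis using \<eta> dist[OF that] by simp
  qed
  have U: "{\<omega>\<in>space \<Omega>. \<exists>k<m. f (fst \<omega> k) \<noteq> g (fst \<omega> k)} = (\<Union>k\<in>{..<m}. ?E k)" by auto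
  show "{\<omega>\<in>space \<Omega>. \<exists>k<m. f (fst \<omega> k) \<noteq> g (fst \<omega> k)} \<in> sets \<Omega>"
    unfolding U using E by auto
  have "measure \<Omega> (\<Union>k\<in>{..<m}. ?E k) \<le> (\<Sum>k\<in>{..<m}. measure \<Omega> (?E k))"
    using E by (intro measure_UNION_le) auto
  also have "\<dots> \<le> (\<Sum>k\<in>{..<m}. \<eta>)" using meas by (intro sum_mono) auto
  finally show "measure \<Omega> {\<omega>\<in>space \<Omega>. \<exists>k<m. f (fst \<omega> k) \<noteq> g (fst \<omega> k)} \<le> real m * \<eta>"
    unfolding U by simp
qed

text \<open>The expected number of events that occur is at least \<open>p * card S\<close>. This
  allows the sample and the seed to be fixed before the index \<open>i\<close>.\<close>

lemma (in prob_space) exists_point_in_many_events: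
  assumes S: "finite S" "S \<noteq> {}"
    and G: "\<And>i. i \<in> S \<Longrightarrow> G i \<in> events" "\<And>i. i \<in> S \<Longrightarrow> prob (G i) \<ge> p"
  shows "\<exists>\<omega>\<in>space M. real (card {i\<in>S. \<omega> \<in> G i}) \<ge> p * real (card S)"
proof (rule ccontr)
  assume "\<not> ?thesis"
  then have less: "real (card {i\<in>S. \<omega> \<in> G i}) < p * real (card S)" if "\<omega> \<in> space M" for \<omega>
    using that by force
  have card: "real (card {i\<in>S. \<omega> \<in> G i}) = (\<Sum>i\<in>S. indicator (G i) \<omega>)" for \<omega>
    using S by (simp add: indicator_def sum.If_cases Int_def)
  have int: "integrable M (\<lambda>\<omega>. \<Sum>i\<in>S. indicator (G i) \<omega> :: real)"
    using G(1) by (intro Bochner_Integration.integrable_sum) (auto simp: less_top[symmetric])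
  have "(\<integral>\<omega>. (\<Sum>i\<in>S. indicator (G i) \<omega> :: real) \<partial>M) < (\<integral>\<omega>. p * real (card S) \<partial>M)"
    using less int
    by (intro integral_less_AE_space) (auto simp: emeasure_space_1 card simp flip: card)
  also have "\<dots> = p * real (card S)" by (simp add: prob_space)
  finally have "(\<Sum>i\<in>S. prob (G i)) < p * real (card S)"
    using G(1) by (subst (asm) Bochner_Integration.integral_sum) (auto simp: less_top[symmetric])
  moreover have "(\<Sum>i\<in>S. p) \<le> (\<Sum>i\<in>S. prob (G i))" using G(2) by (intro sum_mono) auto
  ultimately show False by (simp add: mult.commute)
qed

text \<open>
  The oracle built for \<open>D i\<close> gives the Gaussian answer whenever that is admissible. For some \<open>i\<close> and
  some training sample the learner then sees the same data as under \<open>f_ref\<close> with the Gaussian test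
  distribution, hence accepts, and its hypothesis must be close to both \<open>f_ref\<close> and \<open>f i\<close>.
\<close>

lemma sq_tds_learner_contradiction:
  assumes learner: "sq_tds_learner d C \<epsilon> 0.95 m n \<phi> R A" and \<phi>: "\<phi> > 0"
    and S: "finite S" "S \<noteq> {}"
    and f_ref: "f_ref \<in> C" "f_ref \<in> borel_measurable (borel_space d)"
    and f: "\<And>i. i \<in> S \<Longrightarrow> f i \<in> C" "\<And>i. i \<in> S \<Longrightarrow> f i \<in> borel_measurable (borel_space d)"
    and D: "\<And>i. i \<in> S \<Longrightarrow> prob_space (D i)" "\<And>i. i \<in> S \<Longrightarrow> sets (D i) = sets (borel_space d)"
    and far: "\<And>i. i \<in> S \<Longrightarrow> measure (D i) {x \<in> space (borel_space d). f_ref x \<noteq> f i x} > 2 * \<epsilon>"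
    and close: "\<And>i. i \<in> S \<Longrightarrow>
      real m * measure (std_gaussian d) {x \<in> space (borel_space d). f_ref x \<noteq> f i x} \<le> 1 / 100"
    and sq: "\<And>q. q \<in> sq_queries d \<Longrightarrow>
      real n * real (card {i\<in>S. \<bar>(\<integral>x. q x \<partial>D i) - (\<integral>x. q x \<partial>std_gaussian d)\<bar> > \<phi>}) \<le> real (card S) / 2"
  shows False
proof -
  let ?N = "std_gaussian d"
  define \<Omega> where "\<Omega> = PiM {..<m} (\<lambda>_. ?N) \<Otimes>\<^sub>M R"
  define orc0 where "orc0 q = (\<integral>x. q x \<partial>?N)" for q :: "point \<Rightarrow> real"
  define orc where "orc i q =
    (if \<bar>(\<integral>x. q x \<partial>D i) - orc0 q\<bar> \<le> \<phi> then orc0 q else (\<integral>x. q x \<partial>D i))" for i q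
  define out where "out f orc = (\<lambda>(X, r). run orc (A (labeled_sample m f X) r))" for f orc
  have R: "prob_space R" and A: "at_most_queries d n (A s r)" for s r
    using learner by (auto simp: sq_tds_learner_def)
  have succ: "with_prob_at_least \<Omega> 0.95 (\<lambda>\<omega>. \<forall>h. out f orc \<omega> = Some h \<longrightarrow>
        measure D' {x \<in> space D'. f x \<noteq> h x} \<le> \<epsilon>)"
      and acc: "D' = ?N \<Longrightarrow> with_prob_at_least \<Omega> 0.95 (\<lambda>\<omega>. out f orc \<omega> \<noteq> None)"
    if "f \<in> C" "prob_space D'" "sets D' = sets (borel_space d)" "sq_oracle d \<phi> D' orc" for f D' orc
    using learner that unfolding sq_tds_learner_def Let_def \<Omega>_def out_def by blast+
  have P: "prob_space (PiM {..<m} (\<lambda>_. ?N))" by (intro prob_space_PiM prob_space_std_gaussian)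
  interpret \<Omega>: prob_space \<Omega> unfolding \<Omega>_def by (intro prob_space_pair P R)
  have orc0: "sq_oracle d \<phi> ?N orc0" using \<phi> by (simp add: sq_oracle_def orc0_def)
  have orc: "sq_oracle d \<phi> (D i) (orc i)" for i
    using \<phi> by (auto simp: sq_oracle_def orc_def abs_minus_commute)
  from acc[OF f_ref(1) prob_space_std_gaussian sets_std_gaussian orc0 refl]
  obtain E0 where E0: "E0 \<in> sets \<Omega>" "measure \<Omega> E0 \<ge> 0.95" "\<And>\<omega>. \<omega> \<in> E0 \<Longrightarrow> out f_ref orc0 \<omega> \<noteq> None"
    unfolding with_prob_at_least_def by blast
  \<comment> \<open>Success sets need not be measurable. Each guarantee provides some measurable
    event inside the success set, and one such event is chosen for every \<open>i\<close> and
    \<open>g\<close>.\<close>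
  define \<Phi> where "\<Phi> i g F \<longleftrightarrow> F \<in> sets \<Omega> \<and> measure \<Omega> F \<ge> 0.95 \<and>
      (\<forall>\<omega>\<in>F. \<forall>h. out g (orc i) \<omega> = Some h \<longrightarrow> measure (D i) {x \<in> space (D i). g x \<noteq> h x} \<le> \<epsilon>)"
    for i g F
  define E where "E i g = (SOME F. \<Phi> i g F)" for i g
  have \<Phi>: "\<Phi> i g (E i g)" if "i \<in> S" "g \<in> C" for i g
    unfolding E_def
  proof (rule someI_ex)
    show "\<exists>F. \<Phi> i g F"
      using succ[OF that(2) D(1)[OF that(1)] D(2)[OF that(1)] orc]
      unfolding with_prob_at_least_def \<Phi>_def by blast
  qed
  have E: "E i g \<in> sets \<Omega>" "measure \<Omega> (E i g) \<ge> 0.95"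
      "\<And>\<omega> h. \<omega> \<in> E i g \<Longrightarrow> out g (orc i) \<omega> = Some h \<Longrightarrow>
        measure (D i) {x \<in> space (D i). g x \<noteq> h x} \<le> \<epsilon>"
    if "i \<in> S" "g \<in> C" for i g
    using \<Phi>[OF that] unfolding \<Phi>_def by blast+
  define Diff where "Diff i = {\<omega>\<in>space \<Omega>. \<exists>k<m. f_ref (fst \<omega> k) \<noteq> f i (fst \<omega> k)}" for i
  have Diff: "Diff i \<in> sets \<Omega>" "measure \<Omega> (Diff i) \<le> 1 / 100" if "i \<in> S" for i
  proof -
    note * = sample_disagreement_le[OF R f_ref(2) f(2)[OF that] order.refl, of m, folded \<Omega>_def, folded Diff_def]
    show "Diff i \<in> sets \<Omega>" by (rule *)
    show "measure \<Omega> (Diff i) \<le> 1 / 100" by (rule order.trans[OF *(2) close[OF that]])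
  qed
  \<comment> \<open>Three guarantees, each failing with probability at most 0.05: acceptance on
    Gaussian test data with target \<open>f_ref\<close>, and accuracy under \<open>D i\<close> with
    target \<open>f_ref\<close> and with target \<open>f i\<close>. Removing samples that separate
    the two targets costs another 0.01, which leaves 0.84.\<close>
  define G where "G i = E0 \<inter> E i f_ref \<inter> E i (f i) - Diff i" for i
  have G: "G i \<in> sets \<Omega>" "measure \<Omega> (G i) \<ge> 84 / 100" if i: "i \<in> S" for i
  proof -
    note m = E0(1) E(1)[OF i f_ref(1)] E(1)[OF i f(1)[OF i]] Diff(1)[OF i]
    show "G i \<in> sets \<Omega>" unfolding G_def using m by auto
    let ?U = "(space \<Omega> - E0) \<union> (space \<Omega> - E i f_ref) \<union> (space \<Omega> - E i (f i)) \<union> Diff i"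
    have "measure \<Omega> ?U \<le> measure \<Omega> (space \<Omega> - E0) + measure \<Omega> (space \<Omega> - E i f_ref)
        + measure \<Omega> (space \<Omega> - E i (f i)) + measure \<Omega> (Diff i)"
      using m by (intro order.trans[OF measure_Un_le] add_mono order.refl) auto
    also have "\<dots> \<le> 0.16"
      using m E0(2) E(2)[OF i f_ref(1)] E(2)[OF i f(1)[OF i]] Diff(2)[OF i] by (simp add: \<Omega>.prob_compl)
    finally have U: "measure \<Omega> ?U \<le> 0.16" .
    have "G i = space \<Omega> - ?U"
      unfolding G_def using sets.sets_into_space[OF E0(1)] by auto
    moreover have "?U \<in> sets \<Omega>" using m by auto
    ultimately have "measure \<Omega> (G i) = 1 - measure \<Omega> ?U" by (metis \<Omega>.prob_compl)
    then show "measure \<Omega> (G i) \<ge> 84 / 100" using U by simp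
  qed
  obtain \<omega> where "\<omega> \<in> space \<Omega>" "real (card {i\<in>S. \<omega> \<in> G i}) \<ge> 84 / 100 * real (card S)"
    using \<Omega>.exists_point_in_many_events[of S G "84 / 100", OF S G] by blast
  then obtain X r where \<omega>: "(X, r) \<in> space \<Omega>" "real (card {i\<in>S. (X, r) \<in> G i}) \<ge> 84 / 100 * real (card S)"
    by (cases \<omega>) auto
  define a where "a = A (labeled_sample m f_ref X) r"
  \<comment> \<open>The algorithm state \<open>a\<close> and the oracle \<open>orc0\<close> do not
    involve \<open>i\<close>, so \<open>Q\<close> is fixed before a direction is selected.\<close>
  obtain Q where Q: "finite Q" "card Q \<le> n" "Q \<subseteq> sq_queries d"
      "\<And>orc'. (\<forall>q\<in>Q. orc' q = orc0 q) \<Longrightarrow> run orc' a = run orc0 a"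
    using run_determined_by_few_queries[OF A[of "labeled_sample m f_ref X" r], of orc0, folded a_def]
    by blast
  let ?bad = "\<lambda>q. {i\<in>S. \<bar>(\<integral>x. q x \<partial>D i) - orc0 q\<bar> > \<phi>}"
  \<comment> \<open>At most half of the indices are detected by some query of \<open>Q\<close>,
    while 84 percent are good for the chosen sample and seed; some good index is therefore
    undetected.\<close>
  have "real (card (\<Union>q\<in>Q. ?bad q)) \<le> real (card S) / 2"
  proof (cases "n = 0")
    case True
    then have "Q = {}" using Q by simp
    then show ?thesis by simp
  next
    case False
    have "card (\<Union>q\<in>Q. ?bad q) \<le> (\<Sum>q\<in>Q. card (?bad q))" by (rule card_UN_le[OF Q(1)])
    then have "real (card (\<Union>q\<in>Q. ?bad q)) \<le> (\<Sum>q\<in>Q. real (card (?bad q)))"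
      unfolding of_nat_sum[symmetric] of_nat_le_iff .
    also have "\<dots> \<le> (\<Sum>q\<in>Q. real (card S) / 2 / real n)"
    proof (intro sum_mono)
      fix q assume "q \<in> Q"
      then have "real n * real (card (?bad q)) \<le> real (card S) / 2"
        using sq[of q] Q(3) unfolding orc0_def by blast
      then show "real (card (?bad q)) \<le> real (card S) / 2 / real n"
        using False by (simp add: pos_le_divide_eq mult.commute)
    qed
    also have "\<dots> = real (card Q) / real n * (real (card S) / 2)" by simp
    also have "\<dots> \<le> 1 * (real (card S) / 2)"
      using Q(2) False by (intro mult_right_mono) auto
    finally show ?thesis by simp
  qed
  moreover have "0 < real (card S)" using S by (simp add: card_gt_0_iff)
  ultimately have "real (card (\<Union>q\<in>Q. ?bad q)) < real (card {i\<in>S. (X, r) \<in> G i})"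
    using \<omega>(2) by linarith
  then have "card (\<Union>q\<in>Q. ?bad q) < card {i\<in>S. (X, r) \<in> G i}" by simp
  then have "\<not> {i\<in>S. (X, r) \<in> G i} \<subseteq> (\<Union>q\<in>Q. ?bad q)"
    using card_mono[of "\<Union>q\<in>Q. ?bad q"] S(1) Q(1) by (auto simp: not_le[symmetric])
  then obtain i where i: "i \<in> S" "(X, r) \<in> G i" "\<And>q. q \<in> Q \<Longrightarrow> i \<notin> ?bad q" by auto
  have "orc i q = orc0 q" if "q \<in> Q" for q using i(3)[OF that] i(1) by (auto simp: orc_def)
  then have run: "run (orc i) a = run orc0 a" by (intro Q(4)) auto
  obtain h where h: "run orc0 a = Some h"
    using E0(3)[of "(X, r)"] i(2) by (auto simp: G_def out_def a_def)
  have "labeled_sample m (f i) X = labeled_sample m f_ref X"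
    using i(2) \<omega>(1) by (auto simp: labeled_sample_def G_def Diff_def)
  then have out: "out f_ref (orc i) (X, r) = Some h" "out (f i) (orc i) (X, r) = Some h"
    using run h by (auto simp: out_def a_def)
  interpret Di: prob_space "D i" using D(1)[OF i(1)] .
  have spD: "space (D i) = space (borel_space d)" by (rule sets_eq_imp_space_eq[OF D(2)[OF i(1)]])
  have [simp]: "h \<in> borel_measurable (borel_space d)"
    using run_in_hypotheses[OF A, of orc0 _ r h] h by (auto simp: a_def hypotheses_def)
  have sets: "{x \<in> space (D i). g x \<noteq> h x} \<in> sets (D i)"
    if "g \<in> borel_measurable (borel_space d)" for g :: "point \<Rightarrow> real"
    unfolding D(2)[OF i(1)] spD by (rule borel_measurable_neq) (use that in auto)
  have "measure (D i) {x \<in> space (D i). f_ref x \<noteq> f i x} \<le>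
      measure (D i) ({x \<in> space (D i). f_ref x \<noteq> h x} \<union> {x \<in> space (D i). f i x \<noteq> h x})"
    using sets[OF f_ref(2)] sets[OF f(2)[OF i(1)]] by (intro Di.finite_measure_mono) auto
  also have "\<dots> \<le> measure (D i) {x \<in> space (D i). f_ref x \<noteq> h x} + measure (D i) {x \<in> space (D i). f i x \<noteq> h x}"
    using sets[OF f_ref(2)] sets[OF f(2)[OF i(1)]] by (intro measure_Un_le) auto
  also have "\<dots> \<le> \<epsilon> + \<epsilon>"
    using E(3)[OF i(1) f_ref(1) _ out(1)] E(3)[OF i(1) f(1)[OF i(1)] _ out(2)] i(2)
    by (intro add_mono) (auto simp: G_def)
  finally show False using far[OF i(1)] by (simp add: spD)
qed

section \<open>The hard test distributions\<close>

definition signs :: "nat \<Rightarrow> (nat \<Rightarrow> real) set" where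
  "signs d = PiE {1..<d} (\<lambda>_. {-1, 1})"

text \<open>Directions are orthogonal to the first coordinate axis, the normal of the known halfspace.\<close>

definition direction :: "nat \<Rightarrow> (nat \<Rightarrow> real) \<Rightarrow> point" where
  "direction d \<sigma> i = (if i \<in> {1..<d} then \<sigma> i / sqrt (real (d - 1)) else 0)"

text \<open>\<open>ennreal\<close> truncates negative values, so this is the intended signed
  combination only when \<open>1 + \<beta> * bump t \<Theta> s\<close> is nonnegative. The integral
  and mass lemmas carry this as a hypothesis.\<close>

definition tilted_gaussian :: "nat \<Rightarrow> real \<Rightarrow> nat \<Rightarrow> real \<Rightarrow> point \<Rightarrow> point measure" where
  "tilted_gaussian d \<beta> t \<Theta> v =
     density (std_gaussian d) (\<lambda>x. ennreal (1 + \<beta> * bump t \<Theta> (dot d v x)))"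

lemma finite_signs: "finite (signs d)"
  unfolding signs_def by (intro finite_PiE) auto

lemma signs_nonempty: "signs d \<noteq> {}"
  unfolding signs_def by (simp add: PiE_eq_empty_iff)

lemma abs_signs: "\<sigma> \<in> signs d \<Longrightarrow> i \<in> {1..<d} \<Longrightarrow> \<bar>\<sigma> i\<bar> = 1"
  by (auto simp: signs_def PiE_def Pi_def)

lemma direction_0 [simp]: "direction d \<sigma> 0 = 0"
  by (simp add: direction_def)

lemma dot_direction:
  "dot d (direction d \<sigma>) (direction d \<tau>) = (\<Sum>i\<in>{1..<d}. \<sigma> i * \<tau> i) / real (d - 1)"
proof -
  have "dot d (direction d \<sigma>) (direction d \<tau>) =
      (\<Sum>i\<in>{1..<d}. direction d \<sigma> i * direction d \<tau> i)"
    unfolding dot_def by (rule sum.mono_neutral_right) (auto simp: direction_def)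
  also have "\<dots> = (\<Sum>i\<in>{1..<d}. \<sigma> i * \<tau> i / real (d - 1))"
    by (intro sum.cong) (auto simp: direction_def)
  finally show ?thesis by (simp add: sum_divide_distrib)
qed

lemma dot_direction_self:
  assumes "\<sigma> \<in> signs d" "d \<ge> 2"
  shows "dot d (direction d \<sigma>) (direction d \<sigma>) = 1"
proof -
  have "\<sigma> i * \<sigma> i = 1" if "i \<in> {1..<d}" for i
    using assms(1) that by (auto simp: signs_def PiE_def Pi_def)
  then show ?thesis using assms(2) by (simp add: dot_direction of_nat_diff)
qed

lemma abs_dot_direction_le:
  assumes "\<sigma> \<in> signs d" "\<tau> \<in> signs d"
  shows "\<bar>dot d (direction d \<sigma>) (direction d \<tau>)\<bar> \<le> 1"
proof -
  have "\<bar>\<sigma> i * \<tau> i\<bar> \<le> 1" if "i \<in> {1..<d}" for i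
    using assms that by (simp add: abs_mult abs_signs del: atLeastLessThan_iff)
  then have "\<bar>\<Sum>i\<in>{1..<d}. \<sigma> i * \<tau> i\<bar> \<le> (\<Sum>i\<in>{1..<d}. 1)"
    by (intro order.trans[OF sum_abs] sum_mono)
  then show ?thesis by (auto simp: dot_direction divide_le_eq_1)
qed

lemma card_correlated_directions_le:
  assumes "\<sigma> \<in> signs d" "\<rho> \<ge> 0"
  shows "real (card {\<tau>\<in>signs d. \<bar>dot d (direction d \<sigma>) (direction d \<tau>)\<bar> > \<rho>})
    \<le> 2 * exp (- (\<rho>\<^sup>2 * real (d - 1) / 2)) * real (card (signs d))"
proof -
  have "{\<tau>\<in>signs d. \<bar>dot d (direction d \<sigma>) (direction d \<tau>)\<bar> > \<rho>} \<subseteq>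
      {\<tau>\<in>PiE {1..<d} (\<lambda>_. {-1, 1}). \<bar>\<Sum>i\<in>{1..<d}. \<tau> i * \<sigma> i\<bar> > \<rho> * real (card {1..<d})}"
  proof (intro subsetI CollectI conjI)
    fix \<tau> assume "\<tau> \<in> {\<tau>\<in>signs d. \<bar>dot d (direction d \<sigma>) (direction d \<tau>)\<bar> > \<rho>}"
    then have \<tau>: "\<tau> \<in> signs d" and gt: "\<rho> < \<bar>dot d (direction d \<sigma>) (direction d \<tau>)\<bar>" by auto
    show "\<tau> \<in> PiE {1..<d} (\<lambda>_. {-1, 1})" using \<tau> by (simp add: signs_def)
    have gt': "\<rho> < \<bar>\<Sum>i\<in>{1..<d}. \<tau> i * \<sigma> i\<bar> / real (d - 1)"
      using gt by (simp add: dot_direction mult.commute)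
    \<comment> \<open>If \<open>d - 1\<close> were 0, the quotient would be 0 by convention and
      could not exceed a nonnegative \<rho>.\<close>
    then have "real (d - 1) > 0" using assms(2) by (cases "d - 1 = 0") auto
    then show "\<rho> * real (card {1..<d}) < \<bar>\<Sum>i\<in>{1..<d}. \<tau> i * \<sigma> i\<bar>"
      using gt' by (simp add: pos_less_divide_eq)
  qed
  then have "card {\<tau>\<in>signs d. \<bar>dot d (direction d \<sigma>) (direction d \<tau>)\<bar> > \<rho>} \<le>
      card {\<tau>\<in>PiE {1..<d} (\<lambda>_. {-1, 1}). \<bar>\<Sum>i\<in>{1..<d}. \<tau> i * \<sigma> i\<bar> > \<rho> * real (card {1..<d})}"
    using finite_signs[of d] by (intro card_mono) (auto simp: signs_def)
  then show ?thesis
    using card_signs_correlated_le[of "{1..<d}" \<sigma> \<rho>, OF _ abs_signs[OF assms(1)] assms(2)]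
    by (simp add: signs_def)
qed

lemma abs_node_le: "t \<ge> 1 \<Longrightarrow> \<Theta> \<ge> 1 \<Longrightarrow> \<bar>node t \<Theta> k\<bar> \<le> \<Theta>"
  using divide_le_eq_1_pos[of "real t" "real k"] by (auto simp: node_def simp del: divide_le_eq_1_pos)

text \<open>Every tilt has mean 1, and the weights sum to 0 by the moment condition of order 0. This
  gives the perturbed density total mass 1.\<close>

lemma has_bochner_integral_bump:
  assumes "dot d v v = 1" "t \<ge> 1"
  shows "has_bochner_integral (std_gaussian d) (\<lambda>x. bump t \<Theta> (dot d v x)) 0"
proof -
  have "has_bochner_integral (std_gaussian d) (\<lambda>x. bump t \<Theta> (dot d v x)) (\<Sum>k\<le>Suc t. weight t \<Theta> k * 1)"
    unfolding bump_def
    by (intro has_bochner_integral_sum has_bochner_integral_mult_right has_bochner_integral_tilt assms)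
  then show ?thesis using weight_moments[OF assms(2), of 0] by simp
qed

lemma has_bochner_integral_bump_mult:
  assumes "dot d u u = 1" "dot d v v = 1"
  shows "has_bochner_integral (std_gaussian d) (\<lambda>x. bump t \<Theta> (dot d u x) * bump t \<Theta> (dot d v x))
    (\<Sum>i\<le>Suc t. \<Sum>k\<le>Suc t. weight t \<Theta> i * weight t \<Theta> k * exp (node t \<Theta> i * node t \<Theta> k * dot d u v))"
proof -
  have eq: "bump t \<Theta> (dot d u x) * bump t \<Theta> (dot d v x) =
      (\<Sum>i\<le>Suc t. \<Sum>k\<le>Suc t. weight t \<Theta> i * weight t \<Theta> k *
        (tilt (node t \<Theta> i) (dot d u x) * tilt (node t \<Theta> k) (dot d v x)))" for x
    unfolding bump_def sum_product by (simp only: mult_ac)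
  show ?thesis
    unfolding eq
    by (intro has_bochner_integral_sum has_bochner_integral_mult_right has_bochner_integral_tilt_mult assms)
qed

text \<open>The moment conditions remove all powers of the overlap up to \<open>t\<close>. The
  summand 1 next to the weight bound is the weight of the far node.\<close>

lemma abs_integral_bump_mult_le:
  assumes uv: "dot d u u = 1" "dot d v v = 1" and t: "t \<ge> 1" "\<Theta> \<ge> 1" and \<rho>: "\<bar>dot d u v\<bar> \<le> \<rho>"
  shows "\<bar>\<integral>x. bump t \<Theta> (dot d u x) * bump t \<Theta> (dot d v x) \<partial>std_gaussian d\<bar>
    \<le> (1 + (real t + 1) * (real t * \<Theta>) ^ t)\<^sup>2 * ((\<Theta>\<^sup>2 * \<rho>) ^ Suc t * exp (\<Theta>\<^sup>2 * \<rho>))"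
proof -
  have "\<bar>\<integral>x. bump t \<Theta> (dot d u x) * bump t \<Theta> (dot d v x) \<partial>std_gaussian d\<bar> \<le>
      (\<Sum>k\<in>{..Suc t}. \<bar>weight t \<Theta> k\<bar>)\<^sup>2 *
      ((\<Theta>\<^sup>2 * \<bar>dot d u v\<bar>) ^ Suc t * exp (\<Theta>\<^sup>2 * \<bar>dot d u v\<bar>))"
    unfolding has_bochner_integral_integral_eq[OF has_bochner_integral_bump_mult[OF uv]]
    by (rule abs_sum_exp_le_of_moments) (use weight_moments abs_node_le t in auto)
  also have "\<dots> \<le> (1 + (real t + 1) * (real t * \<Theta>) ^ t)\<^sup>2 * ((\<Theta>\<^sup>2 * \<rho>) ^ Suc t * exp (\<Theta>\<^sup>2 * \<rho>))"
  proof -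
    have "(\<Sum>k\<in>{..Suc t}. \<bar>weight t \<Theta> k\<bar>) \<le> 1 + (real t + 1) * (real t * \<Theta>) ^ t"
      using sum_abs_weight_le[OF t] by (simp add: weight_def)
    moreover have "0 \<le> (\<Sum>k\<in>{..Suc t}. \<bar>weight t \<Theta> k\<bar>)" by (intro sum_nonneg) auto
    moreover have "\<Theta>\<^sup>2 * \<bar>dot d u v\<bar> \<le> \<Theta>\<^sup>2 * \<rho>" using \<rho> by (intro mult_left_mono) auto
    moreover have "0 \<le> \<Theta>\<^sup>2 * \<rho>" using \<rho> by (intro mult_nonneg_nonneg) auto
    ultimately show ?thesis
      using \<rho> t by (intro mult_mono power_mono) auto
  qed
  finally show ?thesis .
qed

text \<open>Up to \<open>\<Theta> - 2\<close> the negative part is at most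
  \<open>M * exp (\<Theta> - 2)\<close>, which \<beta> scales below 1. Beyond,
  \<open>tilt \<Theta> s / exp s\<close> increases in \<open>s\<close>, so it suffices that it is at
  least \<open>2 * M\<close> at \<open>s = \<Theta> - 2\<close>; the exponent in \<open>dom\<close>
  is its logarithm there. The factor 2 preserves half of the positive term.\<close>

lemma bump_lower_bounds:
  fixes \<beta> \<Theta> :: real and t :: nat
  defines "M \<equiv> (real t + 1) * (real t * \<Theta>) ^ t"
  assumes t: "t \<ge> 1" "\<Theta> \<ge> 2" and "\<beta> > 0"
    and small: "\<beta> * M * exp (\<Theta> - 2) \<le> 1"
    and dom: "2 * M \<le> exp ((\<Theta> - 1) * (\<Theta> - 2) - \<Theta>\<^sup>2 / 2)"
  shows "1 + \<beta> * bump t \<Theta> s \<ge> 0"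
    and "s > \<Theta> - 2 \<Longrightarrow> 1 + \<beta> * bump t \<Theta> s \<ge> \<beta> / 2 * tilt \<Theta> s"
proof -
  have M: "M \<ge> 0" unfolding M_def using t by auto
  have ge: "bump t \<Theta> s \<ge> tilt \<Theta> s - M * exp (max s 0)"
    using bump_ge[of t \<Theta> s] t by (simp add: M_def)
  show upper: "1 + \<beta> * bump t \<Theta> s \<ge> \<beta> / 2 * tilt \<Theta> s" if s: "s > \<Theta> - 2"
  proof -
    have "(\<Theta> - 1) * (\<Theta> - 2) \<le> (\<Theta> - 1) * s" using s t by (intro mult_left_mono) auto
    then have "exp ((\<Theta> - 1) * (\<Theta> - 2) - \<Theta>\<^sup>2 / 2) \<le> exp (\<Theta> * s - \<Theta>\<^sup>2 / 2 - s)"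
      by (simp add: algebra_simps)
    also have "\<dots> = tilt \<Theta> s / exp s" by (simp add: tilt_def exp_diff)
    finally have "2 * M \<le> tilt \<Theta> s / exp s" using dom by simp
    then have "2 * M * exp s \<le> tilt \<Theta> s" by (simp add: pos_le_divide_eq)
    moreover have "max s 0 = s" using s t by simp
    ultimately have "bump t \<Theta> s \<ge> tilt \<Theta> s / 2" using ge by simp
    then have "\<beta> * (tilt \<Theta> s / 2) \<le> \<beta> * bump t \<Theta> s" using \<open>\<beta> > 0\<close> by (intro mult_left_mono) auto
    then show ?thesis by simp
  qed
  show "1 + \<beta> * bump t \<Theta> s \<ge> 0"
  proof (cases "s > \<Theta> - 2")
    case True
    have "0 \<le> \<beta> / 2 * tilt \<Theta> s" using \<open>\<beta> > 0\<close> by (simp add: less_imp_le)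
    then show ?thesis using upper[OF True] by linarith
  next
    case False
    then have "exp (max s 0) \<le> exp (\<Theta> - 2)" using t by simp
    then have "M * exp (max s 0) \<le> M * exp (\<Theta> - 2)" using M by (intro mult_left_mono) auto
    then have "- (M * exp (\<Theta> - 2)) \<le> bump t \<Theta> s"
      using ge tilt_pos[of \<Theta> s] by linarith
    then have "\<beta> * - (M * exp (\<Theta> - 2)) \<le> \<beta> * bump t \<Theta> s"
      using \<open>\<beta> > 0\<close> by (intro mult_left_mono) auto
    then show ?thesis using small by (simp add: mult.assoc)
  qed
qed

lemma sets_tilted_gaussian [simp]: "sets (tilted_gaussian d \<beta> t \<Theta> v) = sets (borel_space d)"
  by (simp add: tilted_gaussian_def)

lemma integral_tilted_gaussian:
  fixes q :: "point \<Rightarrow> real"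
  assumes "\<And>s. 1 + \<beta> * bump t \<Theta> s \<ge> 0" and [measurable]: "q \<in> borel_measurable (borel_space d)"
  shows "(\<integral>x. q x \<partial>tilted_gaussian d \<beta> t \<Theta> v) =
    (\<integral>x. (1 + \<beta> * bump t \<Theta> (dot d v x)) * q x \<partial>std_gaussian d)"
  unfolding tilted_gaussian_def by (subst integral_real_density) (use assms(1) in auto)

lemma prob_space_tilted_gaussian:
  assumes v: "dot d v v = 1" "t \<ge> 1" and nonneg: "\<And>s. 1 + \<beta> * bump t \<Theta> s \<ge> 0"
  shows "prob_space (tilted_gaussian d \<beta> t \<Theta> v)"
proof
  interpret N: prob_space "std_gaussian d" by (rule prob_space_std_gaussian)
  note b = has_bochner_integral_mult_right[OF has_bochner_integral_bump[OF v], of \<beta> \<Theta>]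
  have int: "integrable (std_gaussian d) (\<lambda>x. 1 + \<beta> * bump t \<Theta> (dot d v x))"
    and val: "(\<integral>x. 1 + \<beta> * bump t \<Theta> (dot d v x) \<partial>std_gaussian d) = 1"
    using b N.prob_space by (auto simp: has_bochner_integral_iff)
  have sp: "space (tilted_gaussian d \<beta> t \<Theta> v) = space (std_gaussian d)"
    by (simp add: tilted_gaussian_def)
  have "emeasure (tilted_gaussian d \<beta> t \<Theta> v) (space (std_gaussian d)) =
      (\<integral>\<^sup>+x. ennreal (1 + \<beta> * bump t \<Theta> (dot d v x)) * indicator (space (std_gaussian d)) x \<partial>std_gaussian d)"
    unfolding tilted_gaussian_def by (rule emeasure_density) auto
  also have "\<dots> = (\<integral>\<^sup>+x. ennreal (1 + \<beta> * bump t \<Theta> (dot d v x)) \<partial>std_gaussian d)"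
    by (intro nn_integral_cong) (simp add: indicator_def)
  also have "\<dots> = 1"
    using nonneg val by (subst nn_integral_eq_integral[OF int]) auto
  finally show "emeasure (tilted_gaussian d \<beta> t \<Theta> v) (space (tilted_gaussian d \<beta> t \<Theta> v)) = 1"
    by (simp only: sp)
qed

text \<open>The tilt at \<Theta> puts mass at least 1/2 - exp(-2) >= 1/4 on the region, and a
  fraction \<beta>/2 of it survives the correction.\<close>

lemma measure_tilted_gaussian_ge:
  fixes \<beta> \<Theta> :: real
  assumes d: "0 < d" and v: "dot d v v = 1" "v 0 = 0" and t: "t \<ge> 1" and "\<beta> > 0"
    and nonneg: "\<And>s. 1 + \<beta> * bump t \<Theta> s \<ge> 0"
    and large: "\<And>s. s > \<Theta> - 2 \<Longrightarrow> 1 + \<beta> * bump t \<Theta> s \<ge> \<beta> / 2 * tilt \<Theta> s"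
  shows "measure (tilted_gaussian d \<beta> t \<Theta> v)
    {x \<in> space (borel_space d). x 0 \<ge> 0 \<and> dot d v x > \<Theta> - 2} \<ge> \<beta> / 8"
proof -
  interpret D: prob_space "tilted_gaussian d \<beta> t \<Theta> v"
    by (rule prob_space_tilted_gaussian[OF v(1) t nonneg])
  interpret N: prob_space "std_gaussian d" by (rule prob_space_std_gaussian)
  let ?E = "{x \<in> space (borel_space d). x 0 \<ge> 0 \<and> dot d v x > \<Theta> - 2}"
  have [measurable]: "(\<lambda>x. x 0) \<in> borel_measurable (borel_space d)"
    using d by (intro measurable_component_singleton) auto
  have E[measurable]: "?E \<in> sets (borel_space d)" by measurable
  have intb: "integrable (std_gaussian d) (\<lambda>x. 1 + \<beta> * bump t \<Theta> (dot d v x))"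
    using has_bochner_integral_mult_right[OF has_bochner_integral_bump[OF v(1) t], of \<beta> \<Theta>]
    by (simp add: has_bochner_integral_iff)
  have intt: "integrable (std_gaussian d) (\<lambda>x. tilt \<Theta> (dot d v x))"
    using has_bochner_integral_tilt[OF v(1), of \<Theta>] by (simp add: has_bochner_integral_iff)
  have "exp (2::real) \<ge> 4"
    using exp_lower_Taylor_quadratic[of "2::real"] by simp
  then have "exp (- 2 :: real) \<le> 1 / 4"
    by (simp add: exp_minus field_simps)
  then have "1 / 4 \<le> (\<integral>x. indicator ?E x * tilt \<Theta> (dot d v x) \<partial>std_gaussian d)"
    using integral_tilt_upper_ge[OF d v, of \<Theta>] by linarith
  then have "\<beta> / 2 * (1 / 4) \<le> \<beta> / 2 * (\<integral>x. indicator ?E x * tilt \<Theta> (dot d v x) \<partial>std_gaussian d)"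
    using \<open>\<beta> > 0\<close> by (intro mult_left_mono) auto
  also have "\<dots> = (\<integral>x. \<beta> / 2 * (indicator ?E x * tilt \<Theta> (dot d v x)) \<partial>std_gaussian d)"
    by simp
  also have "\<dots> \<le> (\<integral>x. (1 + \<beta> * bump t \<Theta> (dot d v x)) * indicator ?E x \<partial>std_gaussian d)"
  proof (rule integral_mono)
    show "integrable (std_gaussian d) (\<lambda>x. \<beta> / 2 * (indicator ?E x * tilt \<Theta> (dot d v x)))"
      using integrable_mult_indicator[of ?E "std_gaussian d", OF _ intt] E by auto
    show "integrable (std_gaussian d) (\<lambda>x. (1 + \<beta> * bump t \<Theta> (dot d v x)) * indicator ?E x)"
      using integrable_mult_indicator[of ?E "std_gaussian d", OF _ intb] E by (simp add: mult.commute)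
    show "\<beta> / 2 * (indicator ?E x * tilt \<Theta> (dot d v x)) \<le>
        (1 + \<beta> * bump t \<Theta> (dot d v x)) * indicator ?E x" for x
      using large[of "dot d v x"] by (auto simp: indicator_def)
  qed
  also have "\<dots> = (\<integral>x. indicator ?E x \<partial>tilted_gaussian d \<beta> t \<Theta> v)"
    by (rule integral_tilted_gaussian[OF nonneg, symmetric]) measurable
  also have "\<dots> = measure (tilted_gaussian d \<beta> t \<Theta> v) ?E"
    using E by simp
  finally show ?thesis by simp
qed

section \<open>The known halfspace and its hidden truncations\<close>

definition first_halfspace :: "nat \<Rightarrow> point \<Rightarrow> real" where
  "first_halfspace d =
     intersection_of_2_halfspaces d (\<lambda>i. if i = 0 then 1 else 0) 0 (\<lambda>_. 0) 0"

definition truncated_halfspace :: "nat \<Rightarrow> point \<Rightarrow> real \<Rightarrow> point \<Rightarrow> real" where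
  "truncated_halfspace d v \<tau> =
     intersection_of_2_halfspaces d (\<lambda>i. if i = 0 then 1 else 0) 0 (\<lambda>i. - v i) \<tau>"

lemma dot_first_coordinate: "0 < d \<Longrightarrow> dot d (\<lambda>i. if i = 0 then 1 else 0) x = x 0"
  by (simp add: dot_def if_distrib[of "\<lambda>a. a * _"] cong: if_cong)

text \<open>The second normal and offset are zero, so the second constraint reads 0 >= 0: a single
  halfspace is a degenerate member of the class.\<close>

lemma first_halfspace_eq: "0 < d \<Longrightarrow> first_halfspace d x = (if x 0 \<ge> 0 then 1 else -1)"
  by (simp add: first_halfspace_def intersection_of_2_halfspaces_def dot_first_coordinate)
    (simp add: dot_def)

lemma truncated_halfspace_eq:
  "0 < d \<Longrightarrow> truncated_halfspace d v \<tau> x = (if x 0 \<ge> 0 \<and> dot d v x \<le> \<tau> then 1 else -1)"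
  by (simp add: truncated_halfspace_def intersection_of_2_halfspaces_def dot_first_coordinate)
    (simp add: dot_def sum_negf)

lemma halfspaces_disagree:
  "0 < d \<Longrightarrow> {x \<in> space (borel_space d). first_halfspace d x \<noteq> truncated_halfspace d v \<tau> x} =
    {x \<in> space (borel_space d). x 0 \<ge> 0 \<and> dot d v x > \<tau>}"
  by (auto simp: first_halfspace_eq truncated_halfspace_eq)

lemma first_coordinate_measurable [measurable]:
  "0 < d \<Longrightarrow> (\<lambda>x. x 0) \<in> borel_measurable (borel_space d)"
  by (intro measurable_component_singleton) auto

lemma halfspaces_measurable:
  assumes [simp]: "0 < d"
  shows "first_halfspace d \<in> borel_measurable (borel_space d)"
    "truncated_halfspace d v \<tau> \<in> borel_measurable (borel_space d)"
proof -
  note [measurable] = first_coordinate_measurable[OF assms]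
  have "first_halfspace d = (\<lambda>x. if x 0 \<ge> 0 then 1 else -1)"
    by (rule ext) (rule first_halfspace_eq[OF assms])
  then show "first_halfspace d \<in> borel_measurable (borel_space d)" by simp
  have "truncated_halfspace d v \<tau> = (\<lambda>x. if x 0 \<ge> 0 \<and> dot d v x \<le> \<tau> then 1 else -1)"
    by (rule ext) (rule truncated_halfspace_eq[OF assms])
  then show "truncated_halfspace d v \<tau> \<in> borel_measurable (borel_space d)" by simp
qed

lemma disagreement_le:
  assumes "0 < d" "dot d v v = 1" "\<tau> \<ge> 0"
  shows "measure (std_gaussian d)
    {x \<in> space (borel_space d). first_halfspace d x \<noteq> truncated_halfspace d v \<tau> x} \<le> exp (- (\<tau>\<^sup>2 / 2))"
proof -
  interpret prob_space "std_gaussian d" by (rule prob_space_std_gaussian)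
  have "measure (std_gaussian d) {x \<in> space (borel_space d). x 0 \<ge> 0 \<and> dot d v x > \<tau>} \<le>
      measure (std_gaussian d) {x \<in> space (borel_space d). dot d v x > \<tau>}"
  proof (rule finite_measure_mono)
    have "{x \<in> space (borel_space d). dot d v x > \<tau>} \<in> sets (borel_space d)" by measurable
    then show "{x \<in> space (borel_space d). dot d v x > \<tau>} \<in> sets (std_gaussian d)" by simp
  qed auto
  then show ?thesis
    using std_gaussian_tail_le[OF assms(2,3)] by (simp add: halfspaces_disagree[OF assms(1)])
qed

lemma first_halfspace_balanced:
  assumes "0 < d"
  shows "first_halfspace d \<in> balanced_intersections d (1 / 3)"
proof -
  have "{x \<in> space (std_gaussian d). first_halfspace d x = 1} = {x \<in> space (borel_space d). x 0 \<ge> 0}"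
    by (auto simp: first_halfspace_eq[OF assms])
  then have "balanced d (1 / 3) (first_halfspace d)"
    using measure_std_gaussian_nonneg_coordinate[OF assms] by (simp add: balanced_def)
  then show ?thesis by (auto simp: balanced_intersections_def first_halfspace_def)
qed

text \<open>The cut removes at most 1/6 from a halfspace of mass 1/2, which leaves at least
  1/3.\<close>

lemma truncated_halfspace_balanced:
  assumes d: "0 < d" and v: "dot d v v = 1" and \<tau>: "\<tau> \<ge> 0" "exp (- (\<tau>\<^sup>2 / 2)) \<le> 1 / 6"
  shows "truncated_halfspace d v \<tau> \<in> balanced_intersections d (1 / 3)"
proof -
  interpret prob_space "std_gaussian d" by (rule prob_space_std_gaussian)
  note [measurable] = first_coordinate_measurable[OF d]
  let ?A = "{x \<in> space (borel_space d). x 0 \<ge> 0}"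
  let ?B = "{x \<in> space (borel_space d). x 0 \<ge> 0 \<and> dot d v x > \<tau>}"
  have "?A \<in> sets (borel_space d)" "?B \<in> sets (borel_space d)" by measurable
  then have "measure (std_gaussian d) (?A - ?B) = 1 / 2 - measure (std_gaussian d) ?B"
    using measure_std_gaussian_nonneg_coordinate[OF d] by (subst finite_measure_Diff) auto
  moreover have "measure (std_gaussian d) ?B \<le> 1 / 6"
    using disagreement_le[OF d v \<tau>(1)] \<tau>(2) by (simp add: halfspaces_disagree[OF d])
  moreover have region: "{x \<in> space (std_gaussian d). truncated_halfspace d v \<tau> x = 1} = ?A - ?B"
    by (auto simp: truncated_halfspace_eq[OF d])
  ultimately have "balanced d (1 / 3) (truncated_halfspace d v \<tau>)"
    using measure_nonneg[of "std_gaussian d" ?B]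
    unfolding balanced_def region atLeastAtMost_iff by linarith
  then show ?thesis by (auto simp: balanced_intersections_def truncated_halfspace_def)
qed

text \<open>The gap of \<open>q\<close> between the two distributions is its correlation with the
  density deviation \<open>H \<sigma>\<close>, so the sparse counting bound applies. Nearly
  orthogonal pairs have overlap at most \<rho>; for the others the trivial overlap 1 is
  used.\<close>

lemma few_directions_distinguished:
  fixes \<beta> \<Theta> \<rho> \<phi> :: real and t :: nat
  defines "M \<equiv> (real t + 1) * (real t * \<Theta>) ^ t"
  assumes d: "d \<ge> 2" and t: "t \<ge> 1" and \<Theta>: "\<Theta> \<ge> 1" and "\<beta> > 0" "\<phi> > 0" and \<rho>: "\<rho> \<ge> 0"
    and nonneg: "\<And>s. 1 + \<beta> * bump t \<Theta> s \<ge> 0"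
    and weak: "2 * (\<beta>\<^sup>2 * ((1 + M)\<^sup>2 * ((\<Theta>\<^sup>2 * \<rho>) ^ Suc t * exp (\<Theta>\<^sup>2 * \<rho>)))) \<le> \<phi>\<^sup>2"
    and q: "q \<in> sq_queries d"
  shows "real (card {\<sigma>\<in>signs d. \<bar>(\<integral>x. q x \<partial>tilted_gaussian d \<beta> t \<Theta> (direction d \<sigma>))
        - (\<integral>x. q x \<partial>std_gaussian d)\<bar> > \<phi>}) * \<phi>\<^sup>2
    \<le> 2 * (2 * exp (- (\<rho>\<^sup>2 * real (d - 1) / 2))) *
      (\<beta>\<^sup>2 * ((1 + M)\<^sup>2 * ((\<Theta>\<^sup>2) ^ Suc t * exp (\<Theta>\<^sup>2)))) * real (card (signs d))"
proof -
  interpret N: prob_space "std_gaussian d" by (rule prob_space_std_gaussian)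
  define H where "H \<sigma> x = \<beta> * bump t \<Theta> (dot d (direction d \<sigma>) x)" for \<sigma> x
  have qm: "q \<in> borel_measurable (borel_space d)" and qb: "\<And>x. x \<in> space (borel_space d) \<Longrightarrow> \<bar>q x\<bar> \<le> 1"
    using q by (auto simp: sq_queries_def PiE_def Pi_def abs_le_iff)
  have qm': "q \<in> borel_measurable (std_gaussian d)" using qm by simp
  have intq: "integrable (std_gaussian d) q"
    using qb by (intro N.integrable_const_bound[of _ 1] qm') (auto intro!: AE_I2)
  note v = dot_direction_self[OF _ d]
  have intH: "integrable (std_gaussian d) (H \<sigma>)" if "\<sigma> \<in> signs d" for \<sigma>
    unfolding H_def using has_bochner_integral_bump[OF v[OF that] t]
    by (auto simp: has_bochner_integral_iff)
  have HH: "H \<sigma> x * H \<tau> x = \<beta>\<^sup>2 *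
      (bump t \<Theta> (dot d (direction d \<sigma>) x) * bump t \<Theta> (dot d (direction d \<tau>) x))" for \<sigma> \<tau> x
    by (simp add: H_def power2_eq_square mult_ac)
  have intHH: "integrable (std_gaussian d) (\<lambda>x. H \<sigma> x * H \<tau> x)" if "\<sigma> \<in> signs d" "\<tau> \<in> signs d" for \<sigma> \<tau>
    unfolding HH using has_bochner_integral_bump_mult[OF v[OF that(1)] v[OF that(2)]]
    by (auto simp: has_bochner_integral_iff)
  have corr: "\<bar>\<integral>x. H \<sigma> x * H \<tau> x \<partial>std_gaussian d\<bar> \<le>
      \<beta>\<^sup>2 * ((1 + M)\<^sup>2 * ((\<Theta>\<^sup>2 * r) ^ Suc t * exp (\<Theta>\<^sup>2 * r)))"
    if "\<sigma> \<in> signs d" "\<tau> \<in> signs d" "\<bar>dot d (direction d \<sigma>) (direction d \<tau>)\<bar> \<le> r" for \<sigma> \<tau> r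
    unfolding HH M_def
    using abs_integral_bump_mult_le[OF v[OF that(1)] v[OF that(2)] t \<Theta> that(3)]
    by (simp add: abs_mult mult_left_mono)
  let ?B = "{\<sigma>\<in>signs d. \<bar>(\<integral>x. q x \<partial>tilted_gaussian d \<beta> t \<Theta> (direction d \<sigma>))
        - (\<integral>x. q x \<partial>std_gaussian d)\<bar> > \<phi>}"
  have large: "\<phi> \<le> \<bar>\<integral>x. q x * H \<sigma> x \<partial>std_gaussian d\<bar>" if "\<sigma> \<in> ?B" for \<sigma>
  proof -
    have \<sigma>: "\<sigma> \<in> signs d" using that by simp
    have intqH: "integrable (std_gaussian d) (\<lambda>x. q x * H \<sigma> x)"
      using intH[OF \<sigma>] qb qm'
      by (intro Bochner_Integration.integrable_bound[OF intH[OF \<sigma>]])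
        (auto simp: abs_mult intro!: AE_I2 mult_left_le_one_le)
    have "(\<integral>x. q x \<partial>tilted_gaussian d \<beta> t \<Theta> (direction d \<sigma>)) =
        (\<integral>x. q x + q x * H \<sigma> x \<partial>std_gaussian d)"
      unfolding integral_tilted_gaussian[OF nonneg qm] by (simp add: H_def algebra_simps)
    also have "\<dots> = (\<integral>x. q x \<partial>std_gaussian d) + (\<integral>x. q x * H \<sigma> x \<partial>std_gaussian d)"
      by (rule Bochner_Integration.integral_add[OF intq intqH])
    finally show ?thesis using that by simp
  qed
  show ?thesis
  proof (rule N.card_correlated_le_of_sparse[where H = H and q = q and
        P = "\<lambda>\<sigma> \<tau>. \<bar>dot d (direction d \<sigma>) (direction d \<tau>)\<bar> > \<rho>" and
        \<kappa> = "\<beta>\<^sup>2 * ((1 + M)\<^sup>2 * ((\<Theta>\<^sup>2 * \<rho>) ^ Suc t * exp (\<Theta>\<^sup>2 * \<rho>)))"])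
    show "finite (signs d)" "?B \<subseteq> signs d" using finite_signs by auto
    show "q \<in> borel_measurable (std_gaussian d)" by (rule qm')
    show "integrable (std_gaussian d) (H \<sigma>)" if "\<sigma> \<in> signs d" for \<sigma> by (rule intH[OF that])
    show "integrable (std_gaussian d) (\<lambda>x. H \<sigma> x * H \<tau> x)" if "\<sigma> \<in> signs d" "\<tau> \<in> signs d" for \<sigma> \<tau>
      by (rule intHH[OF that])
    show "\<phi> \<le> \<bar>\<integral>x. q x * H \<sigma> x \<partial>std_gaussian d\<bar>" if "\<sigma> \<in> ?B" for \<sigma>
      by (rule large[OF that])
    show "0 < \<phi>" by fact
    show "2 * (\<beta>\<^sup>2 * ((1 + M)\<^sup>2 * ((\<Theta>\<^sup>2 * \<rho>) ^ Suc t * exp (\<Theta>\<^sup>2 * \<rho>)))) \<le> \<phi>\<^sup>2" by fact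
    show "\<bar>q x\<bar> \<le> 1" if "x \<in> space (std_gaussian d)" for x
      using qb that by simp
    show "\<bar>\<integral>x. H \<sigma> x * H \<tau> x \<partial>std_gaussian d\<bar> \<le>
        \<beta>\<^sup>2 * ((1 + M)\<^sup>2 * ((\<Theta>\<^sup>2) ^ Suc t * exp (\<Theta>\<^sup>2)))" if "\<sigma> \<in> signs d" "\<tau> \<in> signs d" for \<sigma> \<tau>
      using corr[OF that abs_dot_direction_le[OF that]] by simp
    show "\<bar>\<integral>x. H \<sigma> x * H \<tau> x \<partial>std_gaussian d\<bar> \<le>
        \<beta>\<^sup>2 * ((1 + M)\<^sup>2 * ((\<Theta>\<^sup>2 * \<rho>) ^ Suc t * exp (\<Theta>\<^sup>2 * \<rho>)))"
      if "\<sigma> \<in> signs d" "\<tau> \<in> signs d" "\<not> \<bar>dot d (direction d \<sigma>) (direction d \<tau>)\<bar> > \<rho>" for \<sigma> \<tau>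
      using corr[OF that(1,2)] that(3) by simp
    show "real (card {\<tau> \<in> signs d. \<rho> < \<bar>dot d (direction d \<sigma>) (direction d \<tau>)\<bar>})
        \<le> 2 * exp (- (\<rho>\<^sup>2 * real (d - 1) / 2)) * real (card (signs d))" if "\<sigma> \<in> signs d" for \<sigma>
      by (rule card_correlated_directions_le[OF that \<rho>])
    show "0 \<le> \<beta>\<^sup>2 * ((1 + M)\<^sup>2 * ((\<Theta>\<^sup>2 * \<rho>) ^ Suc t * exp (\<Theta>\<^sup>2 * \<rho>)))"
      using \<rho> by (intro mult_nonneg_nonneg zero_le_power zero_le_power2 exp_ge_zero)
    show "0 \<le> \<beta>\<^sup>2 * ((1 + M)\<^sup>2 * ((\<Theta>\<^sup>2) ^ Suc t * exp (\<Theta>\<^sup>2)))"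
      by (intro mult_nonneg_nonneg zero_le_power zero_le_power2 exp_ge_zero)
  qed
qed

text \<open>Roles of the conditions: \<open>small\<close> and \<open>dom\<close> make the test
  densities nonnegative, \<open>bal\<close> keeps the truncations in the class, \<open>m\<close>
  hides the cut from the sample, \<open>weak\<close> makes nearly orthogonal pairs harmless at
  tolerance \<phi>, and \<open>n\<close> is the union bound over the queries.\<close>

lemma no_learner:
  fixes \<epsilon> \<Theta> \<rho> \<phi> :: real and t :: nat
  defines "M \<equiv> (real t + 1) * (real t * \<Theta>) ^ t" and "\<beta> \<equiv> 20 * \<epsilon>"
  assumes learner: "sq_tds_learner d (balanced_intersections d (1 / 3)) \<epsilon> 0.95 m n \<phi> R A"
    and \<phi>: "\<phi> > 0" and \<epsilon>: "\<epsilon> > 0" and d: "d \<ge> 2" and t: "t \<ge> 1" and \<Theta>: "\<Theta> \<ge> 2" and \<rho>: "\<rho> \<ge> 0"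
    and small: "\<beta> * M * exp (\<Theta> - 2) \<le> 1"
    and dom: "2 * M \<le> exp ((\<Theta> - 1) * (\<Theta> - 2) - \<Theta>\<^sup>2 / 2)"
    and bal: "exp (- ((\<Theta> - 2)\<^sup>2 / 2)) \<le> 1 / 6"
    and m: "real m * exp (- ((\<Theta> - 2)\<^sup>2 / 2)) \<le> 1 / 100"
    and weak: "2 * (\<beta>\<^sup>2 * ((1 + M)\<^sup>2 * ((\<Theta>\<^sup>2 * \<rho>) ^ Suc t * exp (\<Theta>\<^sup>2 * \<rho>)))) \<le> \<phi>\<^sup>2"
    and n: "real n * (8 * exp (- (\<rho>\<^sup>2 * real (d - 1) / 2)) *
      (\<beta>\<^sup>2 * ((1 + M)\<^sup>2 * ((\<Theta>\<^sup>2) ^ Suc t * exp (\<Theta>\<^sup>2))))) \<le> \<phi>\<^sup>2"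
  shows False
proof (rule sq_tds_learner_contradiction[OF learner \<phi>, where S = "signs d" and f_ref = "first_halfspace d"
      and f = "\<lambda>\<sigma>. truncated_halfspace d (direction d \<sigma>) (\<Theta> - 2)"
      and D = "\<lambda>\<sigma>. tilted_gaussian d \<beta> t \<Theta> (direction d \<sigma>)"])
  have d0: "0 < d" using d by simp
  have \<beta>: "\<beta> > 0" using \<epsilon> by (simp add: \<beta>_def)
  note low = bump_lower_bounds[OF t \<Theta> \<beta> small[unfolded M_def] dom[unfolded M_def]]
  note v = dot_direction_self[OF _ d]
  show "finite (signs d)" "signs d \<noteq> {}" by (rule finite_signs signs_nonempty)+
  show "first_halfspace d \<in> balanced_intersections d (1 / 3)" by (rule first_halfspace_balanced[OF d0])
  show "first_halfspace d \<in> borel_measurable (borel_space d)" by (rule halfspaces_measurable[OF d0])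
  fix \<sigma> assume \<sigma>: "\<sigma> \<in> signs d"
  show "truncated_halfspace d (direction d \<sigma>) (\<Theta> - 2) \<in> balanced_intersections d (1 / 3)"
    by (rule truncated_halfspace_balanced[OF d0 v[OF \<sigma>] _ bal]) (use \<Theta> in simp)
  show "truncated_halfspace d (direction d \<sigma>) (\<Theta> - 2) \<in> borel_measurable (borel_space d)"
    by (rule halfspaces_measurable[OF d0])
  show "prob_space (tilted_gaussian d \<beta> t \<Theta> (direction d \<sigma>))"
    by (rule prob_space_tilted_gaussian[OF v[OF \<sigma>] t low(1)])
  show "sets (tilted_gaussian d \<beta> t \<Theta> (direction d \<sigma>)) = sets (borel_space d)" by simp
  \<comment> \<open>The constant 20 in \<beta> is chosen here: the mass \<beta>/8 equals 2.5
    \<epsilon>, more than two errors of \<epsilon>.\<close>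
  have "2 * \<epsilon> < \<beta> / 8" using \<epsilon> by (simp add: \<beta>_def)
  also have "\<dots> \<le> measure (tilted_gaussian d \<beta> t \<Theta> (direction d \<sigma>))
      {x \<in> space (borel_space d). first_halfspace d x \<noteq> truncated_halfspace d (direction d \<sigma>) (\<Theta> - 2) x}"
    unfolding halfspaces_disagree[OF d0]
    by (rule measure_tilted_gaussian_ge[OF d0 v[OF \<sigma>] direction_0 t \<beta> low])
  finally show "2 * \<epsilon> < measure (tilted_gaussian d \<beta> t \<Theta> (direction d \<sigma>))
      {x \<in> space (borel_space d). first_halfspace d x \<noteq> truncated_halfspace d (direction d \<sigma>) (\<Theta> - 2) x}" .
  have "real m * measure (std_gaussian d) {x \<in> space (borel_space d).
      first_halfspace d x \<noteq> truncated_halfspace d (direction d \<sigma>) (\<Theta> - 2) x} \<le>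
      real m * exp (- ((\<Theta> - 2)\<^sup>2 / 2))"
    using \<Theta> by (intro mult_left_mono disagreement_le d0 v \<sigma>) auto
  then show "real m * measure (std_gaussian d) {x \<in> space (borel_space d).
      first_halfspace d x \<noteq> truncated_halfspace d (direction d \<sigma>) (\<Theta> - 2) x} \<le> 1 / 100"
    using m by linarith
next
  fix q assume q: "q \<in> sq_queries d"
  have \<beta>: "\<beta> > 0" using \<epsilon> by (simp add: \<beta>_def)
  note low = bump_lower_bounds[OF t \<Theta> \<beta> small[unfolded M_def] dom[unfolded M_def]]
  let ?b = "real (card {\<sigma>\<in>signs d. \<bar>(\<integral>x. q x \<partial>tilted_gaussian d \<beta> t \<Theta> (direction d \<sigma>))
        - (\<integral>x. q x \<partial>std_gaussian d)\<bar> > \<phi>})"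
  let ?\<gamma> = "exp (- (\<rho>\<^sup>2 * real (d - 1) / 2))"
  let ?\<nu> = "\<beta>\<^sup>2 * ((1 + M)\<^sup>2 * ((\<Theta>\<^sup>2) ^ Suc t * exp (\<Theta>\<^sup>2)))"
  have "?b * \<phi>\<^sup>2 \<le> 2 * (2 * ?\<gamma>) * ?\<nu> * real (card (signs d))"
    unfolding M_def
    by (rule few_directions_distinguished[OF d t _ \<beta> \<phi> \<rho> low(1) weak[unfolded M_def] q]) (use \<Theta> in auto)
  then have "real n * (?b * \<phi>\<^sup>2) \<le> real n * (2 * (2 * ?\<gamma>) * ?\<nu> * real (card (signs d)))"
    by (intro mult_left_mono) auto
  \<comment> \<open>The 8 is the 4 of the counting bound times 2, since all queries together may
    detect only half of the directions.\<close>
  also have "\<dots> = (real n * (8 * ?\<gamma> * ?\<nu>)) * (real (card (signs d)) / 2)"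
    by simp
  also have "\<dots> \<le> \<phi>\<^sup>2 * (real (card (signs d)) / 2)"
    by (rule mult_right_mono[OF n]) simp
  finally have "\<phi>\<^sup>2 * (real n * ?b) \<le> \<phi>\<^sup>2 * (real (card (signs d)) / 2)"
    by (simp add: mult_ac)
  then show "real n * ?b \<le> real (card (signs d)) / 2"
    using \<phi> by (simp add: mult_le_cancel_left_pos)
qed

section \<open>Choice of parameters\<close>

text \<open>\<open>K\<close> is the exponent in the theorem and \<open>S\<close> the cut T. Here
  \<open>S\<^sup>2 / 2 = 2 * L * K\<close> exceeds the logarithm of the sample bound, at most
  \<open>L * K / 3\<close>, while \<open>S\<close> is o(L), so that \<open>exp S\<close> is
  negligible against \<open>exp L\<close>. The numerical assumptions hold for all large
  \<open>L\<close> and separate the asymptotics from the construction.\<close>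

lemma no_learner_large:
  fixes L \<phi> :: real
  defines "K \<equiv> L / ln L" and "S \<equiv> 2 * L / sqrt (ln L)"
  assumes L: "L \<ge> 3" "ln L \<ge> 1" "K \<ge> 16" "2 + S \<le> L"
    and weights: "(L + 1) * exp (L / 8) \<le> exp (L / 4)" "exp (L / 4) + 1 \<le> exp (L / 3)"
    and small: "20 * exp (- L) * exp (L / 3) * exp S \<le> 1"
    and dom: "2 * exp (L / 4) \<le> exp ((S + 1) * S - (S + 2)\<^sup>2 / 2)"
    and bal: "exp (- (S\<^sup>2 / 2)) \<le> 1 / 6"
    and sample: "exp (L / 3 * K - S\<^sup>2 / 2) \<le> 1 / 100"
    and overlap: "L\<^sup>2 * exp (- (L / 15)) \<le> exp (- (L / 30))"
    and weak: "6 * exp (- (L / 30 * (K / 16))) \<le> exp (- (L / 3 * K / 500))"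
    and strong: "exp (exp (L / 300)) * (8 * exp (- (exp (L / 15) / 2)) * exp (2 * L\<^sup>2)) \<le> exp (- L\<^sup>2)"
    and power: "2 * ln L * (L + 1) \<le> L\<^sup>2"
    and d: "exp (L / 5) + 1 \<le> real d" "real d \<le> exp (L / 3)"
    and learner: "sq_tds_learner d (balanced_intersections d (1 / 3)) (exp (- L)) 0.95 m n \<phi> R A"
    and m: "real m \<le> real d powr K"
    and n: "real n \<le> 2 powr (real d powr g)" "g \<le> 1 / 100"
    and \<phi>: "\<phi> > real d powr (- (1 / 1000) * K)"
  shows False
proof -
  \<comment> \<open>With \<open>t * ln L \<le> L / 16\<close> and \<Theta> at most \<open>L\<close>,
    the weights are of size \<open>L ^ (2 * t) \<le> exp (L / 8)\<close>, up to a linear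
    factor.\<close>
  define t where "t = nat \<lfloor>K / 16\<rfloor>"
  define \<Theta> where "\<Theta> = 2 + S"
  \<comment> \<open>The typical overlap of two directions is about 1/sqrt(d), or exp(-L/8). This
    larger threshold keeps \<open>\<rho>\<^sup>2 * (d - 1)\<close> at least
    \<open>exp (L / 15)\<close>, so that few pairs exceed it.\<close>
  define \<rho> where "\<rho> = exp (- (L / 15))"
  define M where "M = (real t + 1) * (real t * \<Theta>) ^ t"
  define \<beta> where "\<beta> = 20 * exp (- L)"
  have d1: "real d \<ge> 2"
  proof -
    have "exp (L / 5) \<ge> 1" using L by simp
    then show ?thesis using d(1) by linarith
  qed
  then have d0: "real d > 0" "real d \<ge> 1" by auto
  have lnd: "ln (real d) \<le> L / 3" using d(2) d0(1) by (metis ln_exp ln_le_cancel_iff exp_gt_zero)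
  have lnd0: "ln (real d) \<ge> 0" using d0 by simp
  have S0: "S \<ge> 0" using L unfolding S_def by simp
  have \<Theta>2: "\<Theta> - 2 = S" by (simp add: \<Theta>_def)
  have \<Theta>: "\<Theta> \<ge> 2" "\<Theta> \<le> L" using S0 L by (auto simp: \<Theta>_def)
  have t_le: "real t \<le> K / 16" and t_ge: "K / 16 \<le> real (Suc t)" and t1: "t \<ge> 1"
    using L(3) unfolding t_def by linarith+
  have KL: "K \<le> L"
  proof -
    have "L / ln L \<le> L / 1" using L by (intro divide_left_mono) auto
    then show ?thesis by (simp add: K_def)
  qed
  have KlnL: "K * ln L = L" using L by (simp add: K_def)
  have M: "M \<le> exp (L / 4)"
  proof -
    have "(real t * \<Theta>) ^ t \<le> (L * L) ^ t"
      using \<Theta> t_le KL L by (intro power_mono mult_mono) auto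
    also have "\<dots> = exp (2 * real t * ln L)"
    proof -
      have "L * L = exp (2 * ln L)" using L by (simp add: exp_double power2_eq_square)
      then have "(L * L) ^ t = exp (real t * (2 * ln L))" by (simp only: exp_of_nat_mult)
      then show ?thesis by (simp only: mult_ac)
    qed
    also have "\<dots> \<le> exp (L / 8)"
    proof -
      have "2 * real t * ln L \<le> 2 * (K / 16) * ln L"
        using t_le L by (intro mult_right_mono mult_left_mono) auto
      then show ?thesis using KlnL by simp
    qed
    finally have "M \<le> (L + 1) * exp (L / 8)"
      unfolding M_def using \<Theta> t_le KL L by (intro mult_mono) auto
    then show ?thesis using weights by linarith
  qed
  have M0: "M \<ge> 0" unfolding M_def using \<Theta> by simp
  have \<beta>0: "\<beta> > 0" by (simp add: \<beta>_def)
  have \<beta>M: "\<beta> * (1 + M) * exp S \<le> 1"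
  proof -
    have "\<beta> * (1 + M) * exp S \<le> \<beta> * exp (L / 3) * exp S"
      using M weights \<beta>0 by (intro mult_right_mono mult_left_mono) auto
    also have "\<dots> \<le> 1" using small unfolding \<beta>_def .
    finally show ?thesis .
  qed
  have \<beta>M': "\<beta>\<^sup>2 * (1 + M)\<^sup>2 \<le> 1"
  proof -
    have "\<beta> * (1 + M) * 1 \<le> \<beta> * (1 + M) * exp S"
      using \<beta>0 M0 S0 by (intro mult_left_mono) auto
    then have "\<beta> * (1 + M) \<le> 1" using \<beta>M by simp
    then have "(\<beta> * (1 + M))\<^sup>2 \<le> 1"
      using \<beta>0 M0 by (intro power_le_one) auto
    then show ?thesis by (simp add: power_mult_distrib)
  qed
  \<comment> \<open>From \<open>d \<le> exp (L / 3)\<close>: the assumed tolerance exceeds exp(-L K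
    / 3000), and its square exceeds exp(-L K / 1500).\<close>
  have \<phi>_ge: "\<phi>\<^sup>2 \<ge> exp (- (L / 3 * K / 500))"
  proof -
    have "ln (real d) * K \<le> L / 3 * K"
      using lnd L by (intro mult_right_mono) auto
    then have "exp (- (L / 3 * K / 1000)) \<le> exp (- (1 / 1000) * K * ln (real d))"
      by (simp add: mult_ac)
    also have "\<dots> = real d powr (- (1 / 1000) * K)"
      using d0 by (simp add: powr_def)
    also have "\<dots> \<le> \<phi>" using \<phi> by simp
    finally have "(exp (- (L / 3 * K / 1000)))\<^sup>2 \<le> \<phi>\<^sup>2"
      by (intro power_mono) auto
    moreover have "(exp (- (L / 3 * K / 1000)))\<^sup>2 = exp (- (L / 3 * K / 500))"
      by (simp flip: exp_double)
    ultimately show ?thesis by simp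
  qed
  have \<phi>0: "\<phi> > 0" using \<phi> powr_ge_zero by (rule le_less_trans[rotated])
  have z: "0 \<le> \<Theta>\<^sup>2 * \<rho>" "\<Theta>\<^sup>2 * \<rho> \<le> exp (- (L / 30))"
  proof -
    have "\<Theta>\<^sup>2 * \<rho> \<le> L\<^sup>2 * \<rho>"
      using \<Theta> by (intro mult_right_mono power_mono) (auto simp: \<rho>_def)
    also have "\<dots> \<le> exp (- (L / 30))" using overlap unfolding \<rho>_def .
    finally show "\<Theta>\<^sup>2 * \<rho> \<le> exp (- (L / 30))" .
  qed (simp add: \<rho>_def)
  \<comment> \<open>The correlation has order exp(-L K / 480), from
    \<open>t + 1 \<ge> K / 16\<close> factors of at most exp(-L / 30); this is far below exp(-L K /
    1500).\<close>
  have weak': "2 * (\<beta>\<^sup>2 * ((1 + M)\<^sup>2 * ((\<Theta>\<^sup>2 * \<rho>) ^ Suc t * exp (\<Theta>\<^sup>2 * \<rho>)))) \<le> \<phi>\<^sup>2"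
  proof -
    have "(\<Theta>\<^sup>2 * \<rho>) ^ Suc t \<le> exp (- (L / 30)) ^ Suc t" using z by (intro power_mono) auto
    also have "\<dots> = exp (real (Suc t) * - (L / 30))" by (simp only: exp_of_nat_mult)
    also have "\<dots> = exp (- (L / 30 * real (Suc t)))" by (simp add: mult.commute)
    also have "\<dots> \<le> exp (- (L / 30 * (K / 16)))"
      using t_ge L by (simp add: mult_left_mono)
    finally have 1: "(\<Theta>\<^sup>2 * \<rho>) ^ Suc t \<le> exp (- (L / 30 * (K / 16)))" .
    have "\<Theta>\<^sup>2 * \<rho> \<le> 1" 
    proof -
      have "exp (- (L / 30)) \<le> 1" using L by simp
      then show ?thesis using z(2) by linarith
    qed
    then have "exp (\<Theta>\<^sup>2 * \<rho>) \<le> exp 1" by simp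
    then have 2: "exp (\<Theta>\<^sup>2 * \<rho>) \<le> 3" using exp_le by linarith
    have 3: "(\<Theta>\<^sup>2 * \<rho>) ^ Suc t * exp (\<Theta>\<^sup>2 * \<rho>) \<le> exp (- (L / 30 * (K / 16))) * 3"
      using 1 2 z by (intro mult_mono) auto
    have "(\<beta>\<^sup>2 * (1 + M)\<^sup>2) * ((\<Theta>\<^sup>2 * \<rho>) ^ Suc t * exp (\<Theta>\<^sup>2 * \<rho>)) \<le> 1 * (exp (- (L / 30 * (K / 16))) * 3)"
      by (rule mult_mono[OF \<beta>M' 3]) (use z in auto)
    then have "\<beta>\<^sup>2 * ((1 + M)\<^sup>2 * ((\<Theta>\<^sup>2 * \<rho>) ^ Suc t * exp (\<Theta>\<^sup>2 * \<rho>))) \<le>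
        exp (- (L / 30 * (K / 16))) * 3"
      by (simp only: mult.assoc mult_1)
    then show ?thesis using weak \<phi>_ge by linarith
  qed
  have sample': "real m * exp (- ((\<Theta> - 2)\<^sup>2 / 2)) \<le> 1 / 100"
  proof -
    have "real d powr K \<le> exp (L / 3 * K)"
      using d0 lnd L by (simp add: powr_def mult.commute mult_right_mono)
    then have "real m * exp (- (S\<^sup>2 / 2)) \<le> exp (L / 3 * K) * exp (- (S\<^sup>2 / 2))"
      using m by (intro mult_right_mono) auto
    also have "\<dots> = exp (L / 3 * K - S\<^sup>2 / 2)" by (simp flip: exp_add)
    finally show ?thesis using sample unfolding \<Theta>2 by linarith
  qed
  \<comment> \<open>A comparison of double exponentials: at most exp(exp(L / 300)) queries against a
    fraction exp(-exp(L / 15) / 2) of correlated pairs. The crude bound exp(2 L^2) on their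
    correlation is therefore affordable.\<close>
  have n': "real n * (8 * exp (- (\<rho>\<^sup>2 * real (d - 1) / 2)) *
      (\<beta>\<^sup>2 * ((1 + M)\<^sup>2 * ((\<Theta>\<^sup>2) ^ Suc t * exp (\<Theta>\<^sup>2))))) \<le> \<phi>\<^sup>2"
  proof -
    have "real d powr g \<le> real d powr (1 / 100)" using d0 n(2) by (intro powr_mono) auto
    also have "\<dots> \<le> exp (L / 300)" using d0 lnd by (simp add: powr_def)
    finally have g: "real d powr g \<le> exp (L / 300)" .
    have "2 powr (real d powr g) \<le> exp 1 powr (real d powr g)"
      using exp_ge_add_one_self[of 1] by (intro powr_mono2) auto
    also have "\<dots> = exp (real d powr g)" by (simp add: powr_def)
    also have "\<dots> \<le> exp (exp (L / 300))" using g by simp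
    finally have n1: "real n \<le> exp (exp (L / 300))" using n(1) by simp
    have "exp (L / 15) = \<rho>\<^sup>2 * exp (L / 5)"
      by (simp add: \<rho>_def power2_eq_square flip: exp_add)
    also have "\<dots> \<le> \<rho>\<^sup>2 * real (d - 1)"
      using d(1) d1 by (intro mult_left_mono) (auto simp: of_nat_diff)
    finally have e1: "exp (- (\<rho>\<^sup>2 * real (d - 1) / 2)) \<le> exp (- (exp (L / 15) / 2))" by simp
    have "(\<Theta>\<^sup>2) ^ Suc t \<le> (L\<^sup>2) ^ Suc t" using \<Theta> by (intro power_mono) auto
    also have "\<dots> = exp (2 * ln L * real (Suc t))"
    proof -
      have "L\<^sup>2 = exp (2 * ln L)" using L by (simp add: exp_double)
      then have "(L\<^sup>2) ^ Suc t = exp (real (Suc t) * (2 * ln L))" by (simp only: exp_of_nat_mult)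
      then show ?thesis by (simp only: mult_ac)
    qed
    also have "\<dots> \<le> exp (2 * ln L * (L + 1))"
      using t_le KL L by (intro exp_mono mult_left_mono) auto
    also have "\<dots> \<le> exp (L\<^sup>2)" using power by simp
    finally have "(\<Theta>\<^sup>2) ^ Suc t * exp (\<Theta>\<^sup>2) \<le> exp (L\<^sup>2) * exp (L\<^sup>2)"
      using \<Theta> by (intro mult_mono) (auto intro: power_mono)
    also have "\<dots> = exp (2 * L\<^sup>2)" by (simp flip: exp_add)
    finally have e0: "(\<Theta>\<^sup>2) ^ Suc t * exp (\<Theta>\<^sup>2) \<le> exp (2 * L\<^sup>2)" .
    have "(\<beta>\<^sup>2 * (1 + M)\<^sup>2) * ((\<Theta>\<^sup>2) ^ Suc t * exp (\<Theta>\<^sup>2)) \<le> 1 * exp (2 * L\<^sup>2)"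
      by (rule mult_mono[OF \<beta>M' e0]) auto
    then have e2: "\<beta>\<^sup>2 * ((1 + M)\<^sup>2 * ((\<Theta>\<^sup>2) ^ Suc t * exp (\<Theta>\<^sup>2))) \<le> exp (2 * L\<^sup>2)"
      by (simp only: mult.assoc mult_1)
    have "real n * (8 * exp (- (\<rho>\<^sup>2 * real (d - 1) / 2)) *
        (\<beta>\<^sup>2 * ((1 + M)\<^sup>2 * ((\<Theta>\<^sup>2) ^ Suc t * exp (\<Theta>\<^sup>2))))) \<le>
        exp (exp (L / 300)) * (8 * exp (- (exp (L / 15) / 2)) * exp (2 * L\<^sup>2))"
      using e1 by (intro mult_mono n1 e2) auto
    also have "\<dots> \<le> exp (- L\<^sup>2)" by (rule strong)
    also have "\<dots> \<le> exp (- (L / 3 * K / 500))"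
    proof -
      have "L * K \<le> L * L" "0 \<le> L * L" using KL L by auto
      then have "L * K / 1500 \<le> L * L" by linarith
      then show ?thesis by (simp add: power2_eq_square)
    qed
    also have "\<dots> \<le> \<phi>\<^sup>2" by (rule \<phi>_ge)
    finally show ?thesis .
  qed
  show False
  proof (rule no_learner[OF learner \<phi>0, of t \<Theta> \<rho>, folded M_def \<beta>_def])
    show "0 < exp (- L)" by simp
    show "2 \<le> d" using d1 by simp
    show "1 \<le> t" by (rule t1)
    show "2 \<le> \<Theta>" by (rule \<Theta>)
    show "0 \<le> \<rho>" by (simp add: \<rho>_def)
    show "\<beta> * M * exp (\<Theta> - 2) \<le> 1"
    proof -
      have "\<beta> * M * exp S \<le> \<beta> * (1 + M) * exp S"
        using \<beta>0 by (intro mult_right_mono mult_left_mono) auto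
      then show ?thesis using \<beta>M unfolding \<Theta>2 by linarith
    qed
    show "2 * M \<le> exp ((\<Theta> - 1) * (\<Theta> - 2) - \<Theta>\<^sup>2 / 2)"
    proof -
      have "2 * M \<le> exp ((S + 1) * S - (S + 2)\<^sup>2 / 2)" using M dom by linarith
      moreover have "(\<Theta> - 1) * (\<Theta> - 2) - \<Theta>\<^sup>2 / 2 = (S + 1) * S - (S + 2)\<^sup>2 / 2"
        by (simp add: \<Theta>_def add.commute)
      ultimately show ?thesis by simp
    qed
    show "exp (- ((\<Theta> - 2)\<^sup>2 / 2)) \<le> 1 / 6" using bal unfolding \<Theta>2 .
  qed (rule sample' weak' n')+
qed

theorem theorem3p9:
  "\<exists>c::real. c > 0 \<and>
     (\<forall>g::real \<Rightarrow> real. (g \<longlongrightarrow> 0) (at_right 0) \<longrightarrow>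
       (\<forall>\<^sub>F \<epsilon>::real in at_right 0.
          \<forall>d \<in> {nat \<lfloor>\<epsilon> powr (-1/4)\<rfloor>, nat \<lceil>\<epsilon> powr (-1/4)\<rceil>}.
          \<forall>(m::nat) (n::nat) (\<phi>::real) (R::real measure) A.
            \<phi> > 0 \<longrightarrow>
            sq_tds_learner d (balanced_intersections d (1/3)) \<epsilon> 0.95 m n \<phi> R A \<longrightarrow>
            real m \<le> real d powr (ln (1/\<epsilon>) / ln (ln (1/\<epsilon>))) \<longrightarrow>
            real n \<le> 2 powr (real d powr g \<epsilon>) \<longrightarrow>
            \<phi> \<le> real d powr (- c * (ln (1/\<epsilon>) / ln (ln (1/\<epsilon>))))))"
\<comment> \<open>A tolerance d^(-c K) has square at least exp(-2 c L K / 3) when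
  \<open>d \<le> exp (L / 3)\<close>. It stays above the correlation exp(-L K / 480) asymptotically
  for c below 1/320, which 1/1000 satisfies with room.\<close>
proof (intro exI[of _ "1 / 1000"] conjI allI impI)
  show "(0::real) < 1 / 1000" by simp
  fix g :: "real \<Rightarrow> real"
  assume g: "(g \<longlongrightarrow> 0) (at_right 0)"
  have lim: "filterlim (\<lambda>\<epsilon>::real. ln (1 / \<epsilon>)) at_top (at_right 0)" by real_asymp
  \<comment> \<open>The conjuncts are the numerical hypotheses of \<open>no_learner_large\<close> in
    terms of \<open>L\<close> alone; the last one absorbs the rounding of \<open>d\<close>.\<close>
  have "\<forall>\<^sub>F L::real in at_top. L \<ge> 3 \<and> ln L \<ge> 1 \<and> L / ln L \<ge> 16 \<and> 2 + 2 * L / sqrt (ln L) \<le> L \<and>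
     (L + 1) * exp (L / 8) \<le> exp (L / 4) \<and>
     exp (L / 4) + 1 \<le> exp (L / 3) \<and>
     20 * exp (- L) * exp (L / 3) * exp (2 * L / sqrt (ln L)) \<le> 1 \<and>
     2 * exp (L / 4) \<le>
       exp ((2 * L / sqrt (ln L) + 1) * (2 * L / sqrt (ln L)) - (2 * L / sqrt (ln L) + 2)\<^sup>2 / 2) \<and>
     exp (- ((2 * L / sqrt (ln L))\<^sup>2 / 2)) \<le> 1 / 6 \<and>
     exp (L / 3 * (L / ln L) - (2 * L / sqrt (ln L))\<^sup>2 / 2) \<le> 1 / 100 \<and>
     L\<^sup>2 * exp (- (L / 15)) \<le> exp (- (L / 30)) \<and>
     6 * exp (- (L / 30 * (L / ln L / 16))) \<le> exp (- (L / 3 * (L / ln L) / 500)) \<and>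
     exp (exp (L / 300)) * (8 * exp (- (exp (L / 15) / 2)) * exp (2 * L\<^sup>2)) \<le> exp (- L\<^sup>2) \<and>
     2 * ln L * (L + 1) \<le> L\<^sup>2 \<and>
     exp (L / 5) + 1 \<le> exp (L / 4) - 1"
  proof (intro eventually_conj)
    show "\<forall>\<^sub>F L::real in at_top. L \<ge> 3" by real_asymp
    show "\<forall>\<^sub>F L::real in at_top. ln L \<ge> 1" by real_asymp
    show "\<forall>\<^sub>F L::real in at_top. L / ln L \<ge> 16" by real_asymp
    show "\<forall>\<^sub>F L::real in at_top. 2 + 2 * L / sqrt (ln L) \<le> L" by real_asymp
    show "\<forall>\<^sub>F L::real in at_top. (L + 1) * exp (L / 8) \<le> exp (L / 4)" by real_asymp
    show "\<forall>\<^sub>F L::real in at_top. exp (L / 4) + 1 \<le> exp (L / 3)" by real_asymp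
    show "\<forall>\<^sub>F L::real in at_top. 20 * exp (- L) * exp (L / 3) * exp (2 * L / sqrt (ln L)) \<le> 1"
      by real_asymp
    show "\<forall>\<^sub>F L::real in at_top. 2 * exp (L / 4) \<le>
       exp ((2 * L / sqrt (ln L) + 1) * (2 * L / sqrt (ln L)) - (2 * L / sqrt (ln L) + 2)\<^sup>2 / 2)"
      by real_asymp
    show "\<forall>\<^sub>F L::real in at_top. exp (- ((2 * L / sqrt (ln L))\<^sup>2 / 2)) \<le> 1 / 6" by real_asymp
    show "\<forall>\<^sub>F L::real in at_top. exp (L / 3 * (L / ln L) - (2 * L / sqrt (ln L))\<^sup>2 / 2) \<le> 1 / 100"
      by real_asymp
    show "\<forall>\<^sub>F L::real in at_top. L\<^sup>2 * exp (- (L / 15)) \<le> exp (- (L / 30))" by real_asymp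
    show "\<forall>\<^sub>F L::real in at_top. 6 * exp (- (L / 30 * (L / ln L / 16))) \<le> exp (- (L / 3 * (L / ln L) / 500))"
      by real_asymp
    show "\<forall>\<^sub>F L::real in at_top.
        exp (exp (L / 300)) * (8 * exp (- (exp (L / 15) / 2)) * exp (2 * L\<^sup>2)) \<le> exp (- L\<^sup>2)"
      by real_asymp
    show "\<forall>\<^sub>F L::real in at_top. 2 * ln L * (L + 1) \<le> L\<^sup>2" by real_asymp
    show "\<forall>\<^sub>F L::real in at_top. exp (L / 5) + 1 \<le> exp (L / 4) - 1" by real_asymp
  qed
  note parameters = eventually_compose_filterlim[OF this lim]
  \<comment> \<open>The o(1) in the number of queries enters only through this bound.\<close>
  have "\<forall>\<^sub>F \<epsilon> in at_right 0. g \<epsilon> < 1 / 100"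
    by (rule order_tendstoD(2)[OF g]) simp
  moreover have "\<forall>\<^sub>F \<epsilon>::real in at_right 0. \<epsilon> > 0" by (rule eventually_at_right_less)
  ultimately show "\<forall>\<^sub>F \<epsilon>::real in at_right 0.
          \<forall>d \<in> {nat \<lfloor>\<epsilon> powr (-1/4)\<rfloor>, nat \<lceil>\<epsilon> powr (-1/4)\<rceil>}.
          \<forall>(m::nat) (n::nat) (\<phi>::real) (R::real measure) A.
            \<phi> > 0 \<longrightarrow>
            sq_tds_learner d (balanced_intersections d (1/3)) \<epsilon> 0.95 m n \<phi> R A \<longrightarrow>
            real m \<le> real d powr (ln (1/\<epsilon>) / ln (ln (1/\<epsilon>))) \<longrightarrow>
            real n \<le> 2 powr (real d powr g \<epsilon>) \<longrightarrow>
            \<phi> \<le> real d powr (- (1 / 1000) * (ln (1/\<epsilon>) / ln (ln (1/\<epsilon>))))"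
    using parameters
  proof eventually_elim
    case (elim \<epsilon>)
    define L where "L = ln (1 / \<epsilon>)"
    have \<epsilon>: "\<epsilon> = exp (- L)" using elim(2) by (simp add: L_def ln_div)
    have pw: "\<epsilon> powr (-1/4) = exp (L / 4)" by (simp add: \<epsilon> powr_def)
    note p = elim(3)[folded L_def]
    show ?case
    proof (intro ballI allI impI)
      fix d m n \<phi> R A
      assume d: "d \<in> {nat \<lfloor>\<epsilon> powr (-1/4)\<rfloor>, nat \<lceil>\<epsilon> powr (-1/4)\<rceil>}"
        and learner: "sq_tds_learner d (balanced_intersections d (1/3)) \<epsilon> 0.95 m n \<phi> R A"
        and m: "real m \<le> real d powr (ln (1/\<epsilon>) / ln (ln (1/\<epsilon>)))"
        and n: "real n \<le> 2 powr (real d powr g \<epsilon>)"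
      have pos: "exp (L / 4) > 0" by simp
      \<comment> \<open>Both roundings of \<epsilon>^(-1/4) = exp(L / 4) are within 1 of it; the
        exponents 1/5 and 1/3 around 1/4 provide the slack.\<close>
      have "exp (L / 4) - 1 \<le> real d" "real d \<le> exp (L / 4) + 1"
        using d pos unfolding pw by (auto; linarith)+
      then have d': "exp (L / 5) + 1 \<le> real d" "real d \<le> exp (L / 3)"
        using p by linarith+
      show "\<phi> \<le> real d powr (- (1 / 1000) * (ln (1/\<epsilon>) / ln (ln (1/\<epsilon>))))"
      proof (rule ccontr)
        assume "\<not> ?thesis"
        then have \<phi>: "\<phi> > real d powr (- (1 / 1000) * (L / ln L))" by (simp add: L_def)
        show False
          by (rule no_learner_large[of L d m n \<phi> R A "g \<epsilon>"])
            (use p d' learner m n elim(1) \<phi> in \<open>auto simp: \<epsilon>[symmetric] L_def[symmetric]\<close>)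
      qed
    qed
  qed
qed

end
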